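(* Let $X,Y,W$ be mm-spaces and let $\pi\in\mathcal T(\mu_X,\mu_Y)$. Then \[D_\tau^{\pi\otimes\pi_W^\Delta}(X\times_1W,Y\times_1W)=D_\tau^\pi(X,Y).\] Moreover, \[d_\tau(X\times_1W,Y\times_1W)\leq d_\tau(X,Y).\]
   Context: An mm-space is a triple $(X,d_X,\mu_X)$ with $(X,d_X)$ a complete separable metric space and $\mu_X$ a Borel probability measure with full support. $\operatorname{Lip}_1(X)$ is the family of all real-valued $1$-Lipschitz functions on $(X,d_X)$. $\mathcal T(\mu,\nu)$ is the set of couplings of $\mu,\nu$ (Borel probability measures on the product with marginals $\mu,\nu$); $\mathrm{pr}_1,\mathrm{pr}_2$ are the coordinate projections; $(d)_H$ is the Hausdorff distance induced by $d$. $\ell_1$ product: $X\times_1W:=(X\times W,d_{X\times_1W},\mu_X\otimes\mu_W)$ with $d_{X\times_1W}((x,w),(x',w')):=d_X(x,x')+d_W(w,w')$. $\tau:\mathbb R\to(-1/2,1/2)$, $\tau(r)=\frac12\tanh r$. For an mm-space $X$, $\mathsf K_\tau(X)$ is the closure of $\{\tau\circ f\mid f\in\operatorname{Lip}_1(X)\}$ under pointwise convergence on $X$. With $d_{1,\pi}(u,v)=\int|u-v|\,d\pi$, for mm-spaces $X,Y$ set $D_\tau^\pi(X,Y):=(d_{1,\pi})_H(\mathsf K_\tau(X)\circ\mathrm{pr}_1,\mathsf K_\tau(Y)\circ\mathrm{pr}_2)$ for $\pi\in\mathcal T(\mu_X,\mu_Y)$ and $d_\tau(X,Y):=\inf_{\pi\in\mathcal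 T(\mu_X,\mu_Y)}D^\pi_\tau(X,Y)$. $\pi_W^\Delta:=(\operatorname{id}_W,\operatorname{id}_W)_*\mu_W$ is the diagonal coupling of $\mu_W$ with itself; $\pi\otimes\pi_W^\Delta$ is regarded, after the obvious permutation of coordinates, as a coupling of $\mu_X\otimes\mu_W$ and $\mu_Y\otimes\mu_W$ on $(X\times W)\times(Y\times W)$. *)

theory Defs
  imports "HOL-Probability.Probability"
begin

record 'a mms =
  mm_metric :: "'a metric"
  mm_measure :: "'a measure"

abbreviation mm_carrier :: "'a mms \<Rightarrow> 'a set" where
  "mm_carrier X \<equiv> mspace (mm_metric X)"

abbreviation mm_dist :: "'a mms \<Rightarrow> 'a \<Rightarrow> 'a \<Rightarrow> real" where
  "mm_dist X \<equiv> mdist (mm_metric X)"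

abbreviation mm_topology :: "'a mms \<Rightarrow> 'a topology" where
  "mm_topology X \<equiv> mtopology_of (mm_metric X)"

definition borel_of :: "'a topology \<Rightarrow> 'a measure" where
  "borel_of T = sigma (topspace T) {U. openin T U}"

definition mm_space :: "'a mms \<Rightarrow> bool" where
  "mm_space X \<longleftrightarrow>
     mcomplete_of (mm_metric X) \<and>
     separable_space (mm_topology X) \<and>
     sets (mm_measure X) = sets (borel_of (mm_topology X)) \<and>
     prob_space (mm_measure X) \<and>
     (\<forall>U. openin (mm_topology X) U \<and> U \<noteq> {} \<longrightarrow> emeasure (mm_measure X) U > 0)"

definition l1_dist :: "('a \<Rightarrow> 'a \<Rightarrow> real) \<Rightarrow> ('b \<Rightarrow> 'b \<Rightarrow> real) \<Rightarrow> 'a \<times> 'b \<Rightarrow> 'a \<times> 'b \<Rightarrow> real" where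
  "l1_dist d1 d2 = (\<lambda>(x, w) (x', w'). d1 x x' + d2 w w')"

definition l1_prod :: "'a mms \<Rightarrow> 'b mms \<Rightarrow> ('a \<times> 'b) mms" (infixr \<open>\<times>\<^sub>1\<close> 80) where
  "X \<times>\<^sub>1 W =
     \<lparr>mm_metric = metric (mm_carrier X \<times> mm_carrier W, l1_dist (mm_dist X) (mm_dist W)),
      mm_measure = mm_measure X \<Otimes>\<^sub>M mm_measure W\<rparr>"

text \<open>Functions on a space are represented by functions that are \<^const>\<open>extensional\<close> on
  its carrier, so that the space of all of them is \<^const>\<open>product_topology\<close>, whose topology
  is that of pointwise convergence.\<close>

definition Lip1 :: "'a mms \<Rightarrow> ('a \<Rightarrow> real) set" where
  "Lip1 X = {f \<in> extensional (mm_carrier X).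
     \<forall>x\<in>mm_carrier X. \<forall>y\<in>mm_carrier X. \<bar>f x - f y\<bar> \<le> mm_dist X x y}"

definition tau :: "real \<Rightarrow> real" where
  "tau r = tanh r / 2"

definition K_tau :: "'a mms \<Rightarrow> ('a \<Rightarrow> real) set" where
  "K_tau X = product_topology (\<lambda>_. euclideanreal) (mm_carrier X) closure_of
     ((\<lambda>f. restrict (tau \<circ> f) (mm_carrier X)) ` Lip1 X)"

definition couplings :: "'a mms \<Rightarrow> 'b mms \<Rightarrow> ('a \<times> 'b) measure set" where
  "couplings X Y = {\<pi>.
     sets \<pi> = sets (borel_of (prod_topology (mm_topology X) (mm_topology Y))) \<and>
     prob_space \<pi> \<and>
     distr \<pi> (mm_measure X) fst = mm_measure X \<and>
     distr \<pi> (mm_measure Y) snd = mm_measure Y}"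

text \<open>Distances take values in \<^typ>\<open>ennreal\<close>, so that suprema and infima are unconditional.
  On the functions of interest, which are measurable and bounded by \<open>1/2\<close>, the integral below
  is the ordinary one, and all the distances below are at most \<open>1\<close>.\<close>

definition mean_dist :: "'a measure \<Rightarrow> ('a \<Rightarrow> real) \<Rightarrow> ('a \<Rightarrow> real) \<Rightarrow> ennreal" where
  "mean_dist \<pi> u v = (\<integral>\<^sup>+ z. ennreal \<bar>u z - v z\<bar> \<partial>\<pi>)"

definition hausdorff_dist :: "('a \<Rightarrow> 'a \<Rightarrow> ennreal) \<Rightarrow> 'a set \<Rightarrow> 'a set \<Rightarrow> ennreal" where
  "hausdorff_dist d A B = max (SUP a\<in>A. INF b\<in>B. d a b) (SUP b\<in>B. INF a\<in>A. d a b)"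

definition D_tau :: "('a \<times> 'b) measure \<Rightarrow> 'a mms \<Rightarrow> 'b mms \<Rightarrow> ennreal" where
  "D_tau \<pi> X Y =
     hausdorff_dist (mean_dist \<pi>) ((\<lambda>u. u \<circ> fst) ` K_tau X) ((\<lambda>v. v \<circ> snd) ` K_tau Y)"

definition d_tau :: "'a mms \<Rightarrow> 'b mms \<Rightarrow> ennreal" where
  "d_tau X Y = (INF \<pi>\<in>couplings X Y. D_tau \<pi> X Y)"

definition diag_coupling :: "'c mms \<Rightarrow> ('c \<times> 'c) measure" where
  "diag_coupling W =
     distr (mm_measure W) (borel_of (prod_topology (mm_topology W) (mm_topology W))) (\<lambda>w. (w, w))"

definition prod_coupling ::
  "'a mms \<Rightarrow> 'b mms \<Rightarrow> 'c mms \<Rightarrow> ('a \<times> 'b) measure \<Rightarrow> ('c \<times> 'c) measure \<Rightarrow>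
   (('a \<times> 'c) \<times> ('b \<times> 'c)) measure" where
  "prod_coupling X Y W \<pi> \<rho> =
     distr (\<pi> \<Otimes>\<^sub>M \<rho>) (borel_of (prod_topology (mm_topology (X \<times>\<^sub>1 W)) (mm_topology (Y \<times>\<^sub>1 W))))
       (\<lambda>((x, y), (w, w')). ((x, w), (y, w')))"

subsection \<open>The \<open>\<ell>\<^sub>1\<close> product is an mm-space\<close>

lemma space_borel_of [simp]: "space (borel_of T) = topspace T"
  unfolding borel_of_def by (rule space_measure_of) (auto dest: openin_subset)

lemma sets_borel_of: "sets (borel_of T) = sigma_sets (topspace T) {U. openin T U}"
  unfolding borel_of_def by (rule sets_measure_of) (auto dest: openin_subset)

lemma openin_sets_borel_of: "openin T U \<Longrightarrow> U \<in> sets (borel_of T)"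
  by (simp add: sets_borel_of)

lemma Metric_space_l1:
  "Metric_space (mspace m1 \<times> mspace m2) (l1_dist (mdist m1) (mdist m2))"
proof
  fix x y z
  assume "x \<in> mspace m1 \<times> mspace m2" "y \<in> mspace m1 \<times> mspace m2" "z \<in> mspace m1 \<times> mspace m2"
  then show "l1_dist (mdist m1) (mdist m2) x z
      \<le> l1_dist (mdist m1) (mdist m2) x y + l1_dist (mdist m1) (mdist m2) y z"
    using mdist_triangle[of "fst x" m1 "fst y" "fst z"] mdist_triangle[of "snd x" m2 "snd y" "snd z"]
    by (auto simp: l1_dist_def split: prod.splits)
next
  fix x y
  assume "x \<in> mspace m1 \<times> mspace m2" "y \<in> mspace m1 \<times> mspace m2"
  then show "l1_dist (mdist m1) (mdist m2) x y = 0 \<longleftrightarrow> x = y"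
    by (auto simp: l1_dist_def add_nonneg_eq_0_iff)
qed (auto simp: l1_dist_def mdist_commute split: prod.splits)

lemma mm_carrier_l1_prod [simp]: "mm_carrier (X \<times>\<^sub>1 W) = mm_carrier X \<times> mm_carrier W"
  by (simp add: l1_prod_def Metric_space.mspace_metric Metric_space_l1)

lemma mm_dist_l1_prod [simp]:
  "mm_dist (X \<times>\<^sub>1 W) (x, w) (x', w') = mm_dist X x x' + mm_dist W w w'"
proof -
  have "mm_dist (X \<times>\<^sub>1 W) = l1_dist (mm_dist X) (mm_dist W)"
    by (simp add: l1_prod_def Metric_space.mdist_metric[OF Metric_space_l1])
  then show ?thesis by (simp add: l1_dist_def)
qed

lemma mm_measure_l1_prod [simp]: "mm_measure (X \<times>\<^sub>1 W) = mm_measure X \<Otimes>\<^sub>M mm_measure W"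
  by (simp add: l1_prod_def)

lemma openin_mtopology_of:
  "openin (mtopology_of m) U \<longleftrightarrow>
     U \<subseteq> mspace m \<and> (\<forall>x\<in>U. \<exists>r>0. \<forall>y\<in>mspace m. mdist m x y < r \<longrightarrow> y \<in> U)"
proof -
  interpret Metric_space "mspace m" "mdist m" by simp
  show ?thesis
    unfolding mtopology_of_def openin_mtopology subset_iff in_mball by blast
qed

lemma prod_dist_le_l1: "prod_dist (mdist m1) (mdist m2) (x, w) (x', w') \<le> mdist m1 x x' + mdist m2 w w'"
  by (simp add: prod_dist_def sqrt_sum_squares_le_sum)

lemma l1_le_prod_dist:
  "mdist m1 x x' + mdist m2 w w' \<le> 2 * prod_dist (mdist m1) (mdist m2) (x, w) (x', w')"
proof -
  have "mdist m1 x x' \<le> prod_dist (mdist m1) (mdist m2) (x, w) (x', w')"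
    "mdist m2 w w' \<le> prod_dist (mdist m1) (mdist m2) (x, w) (x', w')"
    by (simp_all add: prod_dist_def)
  then show ?thesis by linarith
qed

lemma mm_topology_l1_prod:
  "mm_topology (X \<times>\<^sub>1 W) = prod_topology (mm_topology X) (mm_topology W)"
proof -
  let ?m = "prod_metric (mm_metric X) (mm_metric W)"
  interpret Metric_space12 "mm_carrier X" "mm_dist X" "mm_carrier W" "mm_dist W"
    by (rule Metric_space12_mspace_mdist)
  have *: "mm_dist (X \<times>\<^sub>1 W) p q \<le> 2 * mdist ?m p q" "mdist ?m p q \<le> mm_dist (X \<times>\<^sub>1 W) p q" for p q
    by (cases p; cases q; simp add: prod_dist_le_l1 l1_le_prod_dist)+
  have "openin (mm_topology (X \<times>\<^sub>1 W)) U \<longleftrightarrow> openin (mtopology_of ?m) U" for U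
  proof
    assume L: "openin (mm_topology (X \<times>\<^sub>1 W)) U"
    show "openin (mtopology_of ?m) U"
      unfolding openin_mtopology_of
    proof (intro conjI ballI)
      show "U \<subseteq> mspace ?m" using openin_subset[OF L] by simp
      fix p assume "p \<in> U"
      then obtain r where r: "r > 0" "\<forall>y\<in>mm_carrier (X \<times>\<^sub>1 W). mm_dist (X \<times>\<^sub>1 W) p y < r \<longrightarrow> y \<in> U"
        using L unfolding openin_mtopology_of by blast
      show "\<exists>r>0. \<forall>y\<in>mspace ?m. mdist ?m p y < r \<longrightarrow> y \<in> U"
      proof (intro exI[of _ "r/2"] conjI ballI impI)
        fix y assume "y \<in> mspace ?m" "mdist ?m p y < r/2"
        then show "y \<in> U" using r *(1)[of p y] by (cases y) (auto simp del: mdist_prod_metric)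
      qed (use r in simp)
    qed
  next
    assume R: "openin (mtopology_of ?m) U"
    show "openin (mm_topology (X \<times>\<^sub>1 W)) U"
      unfolding openin_mtopology_of
    proof (intro conjI ballI)
      show "U \<subseteq> mm_carrier (X \<times>\<^sub>1 W)" using openin_subset[OF R] by simp
      fix p assume "p \<in> U"
      then obtain r where r: "r > 0" "\<forall>y\<in>mspace ?m. mdist ?m p y < r \<longrightarrow> y \<in> U"
        using R unfolding openin_mtopology_of by blast
      show "\<exists>r>0. \<forall>y\<in>mm_carrier (X \<times>\<^sub>1 W). mm_dist (X \<times>\<^sub>1 W) p y < r \<longrightarrow> y \<in> U"
      proof (intro exI[of _ r] conjI ballI impI)
        fix y assume "y \<in> mm_carrier (X \<times>\<^sub>1 W)" "mm_dist (X \<times>\<^sub>1 W) p y < r"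
        then show "y \<in> U" using r *(2)[of p y] by (cases y) (auto simp del: mdist_prod_metric)
      qed (use r in simp)
    qed
  qed
  then have "mm_topology (X \<times>\<^sub>1 W) = mtopology_of ?m"
    by (simp add: topology_eq)
  also have "\<dots> = prod_topology (mm_topology X) (mm_topology W)"
    using mtopology_prod_metric by (simp add: mtopology_of_def)
  finally show ?thesis .
qed

lemma mcomplete_l1_prod:
  assumes "mcomplete_of (mm_metric X)" "mcomplete_of (mm_metric W)"
  shows "mcomplete_of (mm_metric (X \<times>\<^sub>1 W))"
proof -
  let ?m = "prod_metric (mm_metric X) (mm_metric W)"
  interpret Metric_space12 "mm_carrier X" "mm_dist X" "mm_carrier W" "mm_dist W"
    by (rule Metric_space12_mspace_mdist)
  interpret L: Metric_space "mm_carrier (X \<times>\<^sub>1 W)" "mm_dist (X \<times>\<^sub>1 W)"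
    by (rule Metric_space_mspace_mdist)
  have C: "Prod_metric.mcomplete"
    using assms mcomplete_prod_metric by (simp add: mcomplete_of_def)
  have T: "L.mtopology = Prod_metric.mtopology"
    using mm_topology_l1_prod[of X W] mtopology_prod_metric by (simp add: mtopology_of_def)
  have le: "prod_dist (mm_dist X) (mm_dist W) p q \<le> mm_dist (X \<times>\<^sub>1 W) p q" for p q
    by (cases p; cases q; simp add: prod_dist_le_l1)
  have "Prod_metric.MCauchy s" if "L.MCauchy s" for s
    using that unfolding Prod_metric.MCauchy_def L.MCauchy_def
    by (metis le mm_carrier_l1_prod order_le_less_trans)
  then have "L.mcomplete"
    using C unfolding L.mcomplete_def Prod_metric.mcomplete_def T by blast
  then show ?thesis by (simp add: mcomplete_of_def)
qed

lemma second_countable_mtopology_of: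
  assumes "separable_space (mtopology_of m)"
  shows "second_countable (mtopology_of m)"
proof -
  interpret Metric_space "mspace m" "mdist m" by simp
  obtain C where C: "countable C" "C \<subseteq> mspace m" "mtopology_of m closure_of C = mspace m"
    using assms by (auto simp: separable_space_def)
  let ?B = "(\<lambda>(c, n). mball c (1 / real (Suc n))) ` (C \<times> UNIV)"
  show ?thesis
    unfolding second_countable_def
  proof (intro exI[of _ ?B] conjI allI impI ballI)
    show "countable ?B" using C by simp
    show "openin (mtopology_of m) V" if "V \<in> ?B" for V
      using that by (auto simp: mtopology_of_def)
    fix U x assume Ux: "openin (mtopology_of m) U \<and> x \<in> U"
    then obtain r where r: "r > 0" "mball x r \<subseteq> U"
      unfolding mtopology_of_def openin_mtopology by blast
    have x: "x \<in> mspace m" using Ux by (auto simp: openin_mtopology_of)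
    obtain n where n: "1 / real (Suc n) < r / 2"
      using r by (metis half_gt_zero nat_approx_posE)
    have "x \<in> mtopology closure_of C" using C x by (simp add: mtopology_of_def)
    then obtain c where c: "c \<in> C" "mdist m x c < 1 / real (Suc n)"
      by (auto simp: metric_closure_of dest!: spec[of _ "1 / real (Suc n)"])
    have "mball c (1 / real (Suc n)) \<subseteq> mball x r"
    proof
      fix z assume z: "z \<in> mball c (1 / real (Suc n))"
      have "mdist m x z \<le> mdist m x c + mdist m c z"
        using z x by (intro triangle) auto
      also have "\<dots> < r" using z c n by simp
      finally show "z \<in> mball x r" using z x by simp
    qed
    moreover have "x \<in> mball c (1 / real (Suc n))"
      using c x C by (auto simp: commute)
    ultimately show "\<exists>V\<in>?B. x \<in> V \<and> V \<subseteq> U"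
      using c r by (intro bexI[of _ "mball c (1 / real (Suc n))"]) auto
  qed
qed

lemma second_countable_prod_topology:
  assumes "second_countable S" "second_countable T"
  shows "second_countable (prod_topology S T)"
proof -
  obtain A where A: "countable A" "\<And>V. V \<in> A \<Longrightarrow> openin S V"
    "\<And>U x. openin S U \<Longrightarrow> x \<in> U \<Longrightarrow> \<exists>V\<in>A. x \<in> V \<and> V \<subseteq> U"
    using assms(1) unfolding second_countable_def by metis
  obtain B where B: "countable B" "\<And>V. V \<in> B \<Longrightarrow> openin T V"
    "\<And>U x. openin T U \<Longrightarrow> x \<in> U \<Longrightarrow> \<exists>V\<in>B. x \<in> V \<and> V \<subseteq> U"
    using assms(2) unfolding second_countable_def by metis
  show ?thesis
    unfolding second_countable_def
  proof (intro exI[of _ "(\<lambda>(a, b). a \<times> b) ` (A \<times> B)"] conjI allI impI ballI)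
    show "countable ((\<lambda>(a, b). a \<times> b) ` (A \<times> B))" using A B by simp
    show "openin (prod_topology S T) V" if "V \<in> (\<lambda>(a, b). a \<times> b) ` (A \<times> B)" for V
      using that A B by (auto simp: openin_prod_Times_iff)
    fix U x assume "openin (prod_topology S T) U \<and> x \<in> U"
    then obtain V W where VW: "openin S V" "openin T W" "fst x \<in> V" "snd x \<in> W" "V \<times> W \<subseteq> U"
      by (metis openin_prod_topology_alt prod.collapse)
    obtain a where "a \<in> A" "fst x \<in> a" "a \<subseteq> V" using A(3) VW by metis
    moreover obtain b where "b \<in> B" "snd x \<in> b" "b \<subseteq> W" using B(3) VW by metis
    ultimately show "\<exists>V\<in>(\<lambda>(a, b). a \<times> b) ` (A \<times> B). x \<in> V \<and> V \<subseteq> U"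
      using VW by (intro bexI[of _ "a \<times> b"]) (auto simp: mem_Times_iff)
  qed
qed

lemma sets_borel_of_prod:
  assumes "second_countable S" "second_countable T"
  shows "sets (borel_of (prod_topology S T)) = sets (borel_of S \<Otimes>\<^sub>M borel_of T)"
proof
  obtain A where A: "countable A" "\<And>V. V \<in> A \<Longrightarrow> openin S V"
    "\<And>U x. openin S U \<Longrightarrow> x \<in> U \<Longrightarrow> \<exists>V\<in>A. x \<in> V \<and> V \<subseteq> U"
    using assms(1) unfolding second_countable_def by metis
  obtain B where B: "countable B" "\<And>V. V \<in> B \<Longrightarrow> openin T V"
    "\<And>U x. openin T U \<Longrightarrow> x \<in> U \<Longrightarrow> \<exists>V\<in>B. x \<in> V \<and> V \<subseteq> U"
    using assms(2) unfolding second_countable_def by metis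
  have "U \<in> sets (borel_of S \<Otimes>\<^sub>M borel_of T)" if U: "openin (prod_topology S T) U" for U
  proof -
    let ?I = "{(a, b) \<in> A \<times> B. a \<times> b \<subseteq> U}"
    have "U \<subseteq> (\<Union>(a, b)\<in>?I. a \<times> b)"
    proof
      fix x assume "x \<in> U"
      then obtain V W where VW: "openin S V" "openin T W" "fst x \<in> V" "snd x \<in> W" "V \<times> W \<subseteq> U"
        using U by (metis openin_prod_topology_alt prod.collapse)
      obtain a where a: "a \<in> A" "fst x \<in> a" "a \<subseteq> V" using A(3) VW by metis
      obtain b where b: "b \<in> B" "snd x \<in> b" "b \<subseteq> W" using B(3) VW by metis
      have "(a, b) \<in> ?I" using a b VW by blast
      then show "x \<in> (\<Union>(a, b)\<in>?I. a \<times> b)"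
        using a b by (intro UN_I[of "(a, b)"]) (auto simp: mem_Times_iff)
    qed
    then have "U = (\<Union>(a, b)\<in>?I. a \<times> b)" by auto
    also have "\<dots> \<in> sets (borel_of S \<Otimes>\<^sub>M borel_of T)"
    proof (rule sets.countable_UN')
      show "countable ?I"
        by (rule countable_subset[of _ "A \<times> B"]) (use A B in auto)
    qed (use A B in \<open>auto intro!: pair_measureI openin_sets_borel_of\<close>)
    finally show ?thesis .
  qed
  then show "sets (borel_of (prod_topology S T)) \<subseteq> sets (borel_of S \<Otimes>\<^sub>M borel_of T)"
    unfolding sets_borel_of[of "prod_topology S T"]
    using sets.sigma_sets_subset[of "{U. openin (prod_topology S T) U}" "borel_of S \<Otimes>\<^sub>M borel_of T"]
    by (simp add: space_pair_measure subset_iff)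
next
  have "fst \<in> borel_of (prod_topology S T) \<rightarrow>\<^sub>M borel_of S"
    unfolding borel_of_def[of S]
  proof (rule measurable_measure_of)
    fix U assume "U \<in> {U. openin S U}"
    then have U: "openin S U" "U \<subseteq> topspace S" using openin_subset by auto
    then have "fst -` U \<inter> space (borel_of (prod_topology S T)) = U \<times> topspace T" by auto
    then show "fst -` U \<inter> space (borel_of (prod_topology S T)) \<in> sets (borel_of (prod_topology S T))"
      using U by (simp add: openin_sets_borel_of openin_prod_Times_iff)
  qed (auto dest: openin_subset)
  moreover have "snd \<in> borel_of (prod_topology S T) \<rightarrow>\<^sub>M borel_of T"
    unfolding borel_of_def[of T]
  proof (rule measurable_measure_of)
    fix U assume "U \<in> {U. openin T U}"
    then have U: "openin T U" "U \<subseteq> topspace T" using openin_subset by auto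
    then have "snd -` U \<inter> space (borel_of (prod_topology S T)) = topspace S \<times> U" by auto
    then show "snd -` U \<inter> space (borel_of (prod_topology S T)) \<in> sets (borel_of (prod_topology S T))"
      using U by (simp add: openin_sets_borel_of openin_prod_Times_iff)
  qed (auto dest: openin_subset)
  ultimately have "(\<lambda>z. (fst z, snd z)) \<in> borel_of (prod_topology S T) \<rightarrow>\<^sub>M borel_of S \<Otimes>\<^sub>M borel_of T"
    by (rule measurable_Pair)
  then have id: "(\<lambda>z. z) \<in> borel_of (prod_topology S T) \<rightarrow>\<^sub>M borel_of S \<Otimes>\<^sub>M borel_of T" by simp
  show "sets (borel_of S \<Otimes>\<^sub>M borel_of T) \<subseteq> sets (borel_of (prod_topology S T))"
  proof
    fix E assume E: "E \<in> sets (borel_of S \<Otimes>\<^sub>M borel_of T)"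
    then have "E \<subseteq> topspace S \<times> topspace T"
      using sets.sets_into_space by (fastforce simp: space_pair_measure)
    then show "E \<in> sets (borel_of (prod_topology S T))"
      using measurable_sets[OF id E] by (simp add: Int_absorb2)
  qed
qed

lemma mm_space_sets_prod:
  assumes "mm_space X" "mm_space Y"
  shows "sets (borel_of (prod_topology (mm_topology X) (mm_topology Y)))
    = sets (mm_measure X \<Otimes>\<^sub>M mm_measure Y)"
proof -
  have "sets (borel_of (prod_topology (mm_topology X) (mm_topology Y)))
      = sets (borel_of (mm_topology X) \<Otimes>\<^sub>M borel_of (mm_topology Y))"
    using assms by (intro sets_borel_of_prod second_countable_mtopology_of) (simp_all add: mm_space_def)
  also have "\<dots> = sets (mm_measure X \<Otimes>\<^sub>M mm_measure Y)"
    using assms by (intro sets_pair_measure_cong) (simp_all add: mm_space_def)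
  finally show ?thesis .
qed

lemma mm_space_space: "mm_space X \<Longrightarrow> space (mm_measure X) = mm_carrier X"
  unfolding mm_space_def by (metis sets_eq_imp_space_eq space_borel_of topspace_mtopology_of)

lemma mm_space_l1_prod:
  assumes X: "mm_space X" and W: "mm_space W"
  shows "mm_space (X \<times>\<^sub>1 W)"
proof -
  interpret PX: prob_space "mm_measure X" using X by (simp add: mm_space_def)
  interpret PW: prob_space "mm_measure W" using W by (simp add: mm_space_def)
  interpret P: pair_prob_space "mm_measure X" "mm_measure W" ..
  have "emeasure (mm_measure X \<Otimes>\<^sub>M mm_measure W) U > 0"
    if U: "openin (prod_topology (mm_topology X) (mm_topology W)) U" and "U \<noteq> {}" for U
  proof -
    obtain x w where xw: "(x, w) \<in> U" using \<open>U \<noteq> {}\<close> by (metis all_not_in_conv surj_pair)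
    have "\<exists>A B. openin (mm_topology X) A \<and> openin (mm_topology W) B \<and> x \<in> A \<and> w \<in> B \<and> A \<times> B \<subseteq> U"
      using U xw unfolding openin_prod_topology_alt by simp
    then obtain A B where AB: "openin (mm_topology X) A" "openin (mm_topology W) B"
        "x \<in> A" "w \<in> B" "A \<times> B \<subseteq> U"
      by (elim exE conjE)
    have s: "A \<in> sets (mm_measure X)" "B \<in> sets (mm_measure W)"
      using AB X W by (simp_all add: mm_space_def openin_sets_borel_of)
    have "A \<noteq> {}" "B \<noteq> {}" using AB by auto
    then have "emeasure (mm_measure X) A > 0" "emeasure (mm_measure W) B > 0"
      using AB X W by (simp_all add: mm_space_def)
    then have "0 < emeasure (mm_measure X) A * emeasure (mm_measure W) B"
      by (simp add: ennreal_zero_less_mult_iff)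
    also have "\<dots> = emeasure (mm_measure X \<Otimes>\<^sub>M mm_measure W) (A \<times> B)"
      using s by (simp add: PW.emeasure_pair_measure_Times)
    also have "\<dots> \<le> emeasure (mm_measure X \<Otimes>\<^sub>M mm_measure W) U"
      using AB openin_sets_borel_of[OF U] mm_space_sets_prod[OF X W] by (intro emeasure_mono) simp_all
    finally show ?thesis .
  qed
  moreover have "separable_space (prod_topology (mm_topology X) (mm_topology W))"
    using X W by (simp add: mm_space_def second_countable_imp_separable_space
        second_countable_prod_topology second_countable_mtopology_of)
  ultimately show ?thesis
    using X W mm_space_sets_prod[OF X W] P.prob_space_axioms mcomplete_l1_prod[of X W]
    unfolding mm_space_def mm_topology_l1_prod mm_measure_l1_prod by simp
qed

subsection \<open>The product coupling is a coupling\<close>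

lemma diag_coupling_in_couplings:
  assumes W: "mm_space W"
  shows "diag_coupling W \<in> couplings W W"
proof -
  interpret prob_space "mm_measure W" using W by (simp add: mm_space_def)
  let ?B = "borel_of (prod_topology (mm_topology W) (mm_topology W))"
  note [measurable_cong] = mm_space_sets_prod[OF W W]
  have [measurable]: "(\<lambda>w. (w, w)) \<in> mm_measure W \<rightarrow>\<^sub>M ?B" by measurable
  show ?thesis
    unfolding couplings_def diag_coupling_def
    by (auto intro!: prob_space_distr simp: distr_distr comp_def distr_id2)
qed

lemma prod_coupling_in_couplings:
  assumes X: "mm_space X" and Y: "mm_space Y" and W: "mm_space W" and pi: "\<pi> \<in> couplings X Y"
  shows "prod_coupling X Y W \<pi> (diag_coupling W) \<in> couplings (X \<times>\<^sub>1 W) (Y \<times>\<^sub>1 W)"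
proof -
  let ?\<rho> = "diag_coupling W"
  let ?B = "borel_of (prod_topology (mm_topology (X \<times>\<^sub>1 W)) (mm_topology (Y \<times>\<^sub>1 W)))"
  let ?g = "\<lambda>((x, y), (w, w')). ((x, w), (y, w'))"
  note rho = diag_coupling_in_couplings[OF W]
  have sp [measurable_cong]: "sets \<pi> = sets (mm_measure X \<Otimes>\<^sub>M mm_measure Y)"
    using pi mm_space_sets_prod[OF X Y] by (simp add: couplings_def)
  have sr [measurable_cong]: "sets ?\<rho> = sets (mm_measure W \<Otimes>\<^sub>M mm_measure W)"
    using rho mm_space_sets_prod[OF W W] by (simp add: couplings_def)
  have [measurable_cong]: "sets ?B = sets ((mm_measure X \<Otimes>\<^sub>M mm_measure W) \<Otimes>\<^sub>M (mm_measure Y \<Otimes>\<^sub>M mm_measure W))"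
    using mm_space_sets_prod[OF mm_space_l1_prod[OF X W] mm_space_l1_prod[OF Y W]] by simp
  interpret P: prob_space \<pi> using pi by (simp add: couplings_def)
  interpret R: prob_space ?\<rho> using rho by (simp add: couplings_def)
  interpret PR: pair_prob_space \<pi> ?\<rho> ..
  interpret WW: prob_space "mm_measure W" using W by (simp add: mm_space_def)
  have g [measurable]: "?g \<in> \<pi> \<Otimes>\<^sub>M ?\<rho> \<rightarrow>\<^sub>M ?B"
    unfolding split_beta' by measurable
  have m1: "distr \<pi> (mm_measure X) fst = mm_measure X" "distr \<pi> (mm_measure Y) snd = mm_measure Y"
    using pi by (auto simp: couplings_def)
  have m2: "distr ?\<rho> (mm_measure W) fst = mm_measure W" "distr ?\<rho> (mm_measure W) snd = mm_measure W"
    using rho by (auto simp: couplings_def)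
  have 1: "distr (distr (\<pi> \<Otimes>\<^sub>M ?\<rho>) ?B ?g) (mm_measure X \<Otimes>\<^sub>M mm_measure W) fst
      = mm_measure X \<Otimes>\<^sub>M mm_measure W"
  proof -
    have "distr \<pi> (mm_measure X) fst \<Otimes>\<^sub>M distr ?\<rho> (mm_measure W) fst
      = distr (\<pi> \<Otimes>\<^sub>M ?\<rho>) (mm_measure X \<Otimes>\<^sub>M mm_measure W) (\<lambda>(p, q). (fst p, fst q))"
      by (rule pair_measure_distr) (auto simp: m2 WW.sigma_finite_measure)
    then show ?thesis
      by (simp add: m1 m2 distr_distr comp_def split_beta')
  qed
  have 2: "distr (distr (\<pi> \<Otimes>\<^sub>M ?\<rho>) ?B ?g) (mm_measure Y \<Otimes>\<^sub>M mm_measure W) snd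
      = mm_measure Y \<Otimes>\<^sub>M mm_measure W"
  proof -
    have "distr \<pi> (mm_measure Y) snd \<Otimes>\<^sub>M distr ?\<rho> (mm_measure W) snd
      = distr (\<pi> \<Otimes>\<^sub>M ?\<rho>) (mm_measure Y \<Otimes>\<^sub>M mm_measure W) (\<lambda>(p, q). (snd p, snd q))"
      by (rule pair_measure_distr) (auto simp: m2 WW.sigma_finite_measure)
    then show ?thesis
      by (simp add: m1 m2 distr_distr comp_def split_beta')
  qed
  have "prob_space (distr (\<pi> \<Otimes>\<^sub>M ?\<rho>) ?B ?g)" using g by (rule PR.prob_space_distr)
  then show ?thesis
    using 1 2 by (simp add: couplings_def prod_coupling_def)
qed

end

theory Submission
  imports Defs
begin

text \<open>
  Fix a coupling. The inequality \<open>\<ge>\<close> follows by lifting functions from \<open>X\<close> to \<open>X \<times>\<^sub>1 W\<close> and by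
  choosing a good fibre over \<open>W\<close>. For \<open>\<le>\<close>, let \<open>F\<close> be 1-Lipschitz on \<open>X \<times>\<^sub>1 W\<close> and let \<open>g\<^sub>w\<close> be a
  (nearly) best approximant on \<open>Y\<close> of the slice \<open>F\<^sub>w\<close>. The function
  \<open>G(y, w) = max\<^sub>i (g\<^sub>c\<^sub>i(y) - d(w, c\<^sub>i))\<close>, for finitely many points \<open>c\<^sub>i\<close> of a dense sequence in \<open>W\<close>, is
  1-Lipschitz for the \<open>\<ell>\<^sub>1\<close> distance. Its slice at each \<open>c\<^sub>i\<close> is still nearly optimal by an exchange
  argument: if \<open>f' \<le> f + s\<close> and \<open>g, g'\<close> are nearly optimal for \<open>f, f'\<close>, then so is
  \<open>max g (g' - s)\<close> for \<open>f\<close>. For an unweighted \<open>L\<^sup>1\<close> distance this is submodularity and translation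
  invariance; \<open>\<tau>\<close> breaks translation invariance, and the replacement is that
  \<open>\<tau>(r) \<mapsto> \<tau>(r + s)\<close> is concave for \<open>s \<ge> 0\<close>. Densely many good slices suffice by continuity in \<open>w\<close>
  and dominated convergence.
\<close>

section \<open>The tanh flow on the interval\<close>

text \<open>The addition formula of \<open>tanh\<close>, read as a Moebius map in \<open>z\<close>:
  translation by \<open>s\<close> in the coordinate \<open>artanh z\<close>. The rational form also
  makes sense at 1 and -1, which it fixes.\<close>

definition flow :: "real \<Rightarrow> real \<Rightarrow> real" where
  "flow s z = (z + tanh s) / (1 + tanh s * z)"

lemma flow_denom_pos: "\<bar>z\<bar> \<le> 1 \<Longrightarrow> 1 + tanh s * z > (0::real)"
proof -
  assume z: "\<bar>z\<bar> \<le> 1"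
  have t: "\<bar>tanh s\<bar> < 1" using tanh_real_lt_1[of s] tanh_real_gt_neg1[of s] by linarith
  have "\<bar>tanh s * z\<bar> \<le> \<bar>tanh s\<bar> * 1" unfolding abs_mult using z by (intro mult_left_mono) auto
  then show ?thesis using t by linarith
qed

text \<open>The exact difference quotient of a Moebius map: determinant over the product of the two
  denominators. Monotonicity, slope bounds and concavity are all read off from it.\<close>

lemma flow_diff:
  assumes "\<bar>z\<bar> \<le> 1" "\<bar>z'\<bar> \<le> 1"
  shows "flow s z' - flow s z = (z' - z) * ((1 - (tanh s)\<^sup>2) / ((1 + tanh s * z) * (1 + tanh s * z')))"
  using flow_denom_pos[OF assms(1), of s] flow_denom_pos[OF assms(2), of s]
  unfolding flow_def by (simp add: field_simps power2_eq_square)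

lemma tanh_square_less_1: "(tanh (s::real))\<^sup>2 < 1"
  using tanh_real_lt_1[of s] tanh_real_gt_neg1[of s] by (simp add: abs_square_less_1)

lemma flow_mono:
  assumes "\<bar>z\<bar> \<le> 1" "\<bar>z'\<bar> \<le> 1" "z \<le> z'"
  shows "flow s z \<le> flow s z'"
proof -
  have "0 \<le> (z' - z) * ((1 - (tanh s)\<^sup>2) / ((1 + tanh s * z) * (1 + tanh s * z')))"
    using assms tanh_square_less_1[of s] flow_denom_pos[of z s] flow_denom_pos[of z' s]
    by (intro mult_nonneg_nonneg divide_nonneg_nonneg) auto
  then show ?thesis using flow_diff[OF assms(1,2), of s] by linarith
qed

lemma flow_one [simp]: "flow s 1 = 1" "flow s (-1) = -1"
  using flow_denom_pos[of 1 s] flow_denom_pos[of "-1" s] by (auto simp: flow_def field_simps)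

lemma flow_zero [simp]: "flow 0 z = z"
  by (simp add: flow_def)

lemma abs_flow_le: "\<bar>z\<bar> \<le> 1 \<Longrightarrow> \<bar>flow s z\<bar> \<le> 1"
  using flow_mono[of z 1 s] flow_mono[of "-1" z s] by (simp add: abs_le_iff)

lemma flow_tanh: "flow s (tanh r) = tanh (r + s)"
  unfolding flow_def by (subst tanh_add) (auto simp: mult.commute)

lemma tanh_artanh_real:
  assumes "\<bar>z::real\<bar> < 1"
  shows "tanh (artanh z) = z"
proof -
  have pos: "(1 + z) / (1 - z) > 0" using assms by auto
  have "exp (- 2 * artanh z) = inverse ((1 + z) / (1 - z))"
    using pos by (simp add: artanh_def exp_minus)
  then have e: "exp (- 2 * artanh z) = (1 - z) / (1 + z)" by simp
  show ?thesis
    unfolding tanh_real_altdef e using assms by (simp add: field_simps)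
qed

text \<open>Inside the interval the flow is translation conjugated by \<open>tanh\<close>, so times
  add; the endpoints are fixed.\<close>

lemma flow_add:
  assumes z: "\<bar>z\<bar> \<le> 1"
  shows "flow s (flow r z) = flow (s + r) z"
proof -
  consider "z = 1" | "z = -1" | "\<bar>z\<bar> < 1" using z by linarith
  then show ?thesis
  proof cases
    case 3
    then have "tanh (artanh z) = z" by (rule tanh_artanh_real)
    then show ?thesis using flow_tanh[of r "artanh z"] flow_tanh[of s "artanh z + r"]
        flow_tanh[of "s + r" "artanh z"] by (simp add: add_ac)
  qed auto
qed

lemma flow_commute: "\<bar>z\<bar> \<le> 1 \<Longrightarrow> flow s (flow r z) = flow r (flow s z)"
  by (simp add: flow_add add.commute)

lemma flow_mono_time:
  assumes z: "\<bar>z\<bar> \<le> 1" and "s \<le> r"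
  shows "flow s z \<le> flow r z"
proof -
  consider "z = 1" | "z = -1" | "\<bar>z\<bar> < 1" using z by linarith
  then show ?thesis
  proof cases
    case 3
    then have "tanh (artanh z) = z" by (rule tanh_artanh_real)
    then show ?thesis using flow_tanh[of r "artanh z"] flow_tanh[of s "artanh z"] \<open>s \<le> r\<close> by simp
  qed auto
qed

text \<open>A crude speed bound. The constant 4 is not optimal; any constant yields the Lipschitz
  estimate behind measurability and continuity along \<open>W\<close>.\<close>

lemma flow_le_add:
  assumes z: "\<bar>z\<bar> \<le> 1" and s: "s \<ge> 0"
  shows "flow s z \<le> z + 4 * s"
proof -
  define T where "T = tanh s"
  have T: "0 \<le> T" "T < 1" using s tanh_real_lt_1 by (auto simp: T_def)
  have pos: "1 + T * z > 0" using flow_denom_pos[OF z, of s] by (simp add: T_def)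
  have "T \<le> s"
  proof -
    have "norm (tanh s - tanh 0) \<le> 1 * norm (s - 0)"
    proof (rule field_differentiable_bound[of UNIV])
      fix x :: real
      show "(tanh has_field_derivative (1 - tanh x ^ 2)) (at x within UNIV)"
        by (auto intro!: derivative_eq_intros)
      show "norm (1 - (tanh x)\<^sup>2) \<le> 1" using tanh_square_less_1[of x] by simp
    qed auto
    then show ?thesis using T s by (simp add: T_def)
  qed
  \<comment> \<open>The factor \<open>1 + z\<close> of the numerator absorbs the denominator, which
    may be close to 0 when \<open>z\<close> is near -1.\<close>
  have den: "1 + z \<le> 2 * (1 + T * z)"
  proof (cases "z \<ge> 0")
    case True
    then have "T * z \<ge> 0" using T by simp
    then show ?thesis using z by (simp add: abs_le_iff)
  next
    case False
    then have "T * z \<ge> 1 * z" using T by (intro mult_right_mono_neg) auto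
    then show ?thesis using z by (simp add: abs_le_iff)
  qed
  have "flow s z - z = T * (1 - z) * (1 + z) / (1 + T * z)"
    using pos by (simp add: flow_def T_def[symmetric] field_simps power2_eq_square)
  also have "\<dots> \<le> T * (1 - z) * (2 * (1 + T * z)) / (1 + T * z)"
    using T z den pos by (intro divide_right_mono mult_left_mono) auto
  also have "\<dots> = T * (2 * (1 - z))" using pos by (simp add: field_simps)
  also have "\<dots> \<le> s * 4" using T z \<open>T \<le> s\<close> by (intro mult_mono) auto
  finally show ?thesis by simp
qed

text \<open>The derivatives of \<^term>\<open>flow s\<close> at \<open>-1\<close> and at \<open>1\<close>; for \<open>s \<ge> 0\<close> they are its extreme slopes.\<close>

definition slope_max :: "real \<Rightarrow> real" where "slope_max s = (1 + tanh s) / (1 - tanh s)"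
definition slope_min :: "real \<Rightarrow> real" where "slope_min s = (1 - tanh s) / (1 + tanh s)"

section \<open>Slope bounds and concavity of the flow\<close>

lemma slope_pos: "slope_max s > 0" "slope_min s > 0"
  using tanh_real_lt_1[of s] tanh_real_gt_neg1[of s] by (auto simp: slope_max_def slope_min_def)

text \<open>\<open>S\<close> is the difference quotient from \<open>flow_diff\<close>. For
  \<open>s \<ge> 0\<close> each factor of its denominator lies between \<open>1 - tanh s\<close> and
  \<open>1 + tanh s\<close>.\<close>

lemma flow_slope_bounds:
  assumes "\<bar>z\<bar> \<le> 1" "\<bar>z'\<bar> \<le> 1" "s \<ge> 0"
  defines "S \<equiv> (1 - (tanh s)\<^sup>2) / ((1 + tanh s * z) * (1 + tanh s * z'))"
  shows "slope_min s \<le> S" "S \<le> slope_max s"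
proof -
  define T where "T = tanh s"
  have T: "0 \<le> T" "T < 1" using assms(3) tanh_real_lt_1 by (auto simp: T_def)
  have pos: "1 + T * z > 0" "1 + T * z' > 0"
    using flow_denom_pos[OF assms(1), of s] flow_denom_pos[OF assms(2), of s] by (simp_all add: T_def)
  have b: "- T \<le> T * x \<and> T * x \<le> T" if "\<bar>x\<bar> \<le> 1" for x
    using mult_left_mono[of x 1 T] mult_left_mono[of "-1" x T] that T by auto
  have num: "1 - T\<^sup>2 = (1 - T) * (1 + T)" "1 - T\<^sup>2 \<ge> 0"
    using tanh_square_less_1[of s] by (auto simp: T_def power2_eq_square algebra_simps)
  have "(1 - T\<^sup>2) / ((1 + T) * (1 + T)) \<le> (1 - T\<^sup>2) / ((1 + T * z) * (1 + T * z'))"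
    using num pos b[OF assms(1)] b[OF assms(2)] T by (intro divide_left_mono mult_mono) auto
  moreover have "(1 - T\<^sup>2) / ((1 + T) * (1 + T)) = slope_min s"
    using T num by (simp add: slope_min_def T_def[symmetric])
  ultimately show "slope_min s \<le> S" by (simp add: S_def T_def)
  have "(1 - T\<^sup>2) / ((1 + T * z) * (1 + T * z')) \<le> (1 - T\<^sup>2) / ((1 - T) * (1 - T))"
    using num pos b[OF assms(1)] b[OF assms(2)] T by (intro divide_left_mono mult_mono) auto
  moreover have "(1 - T\<^sup>2) / ((1 - T) * (1 - T)) = slope_max s"
    using T num by (simp add: slope_max_def T_def[symmetric])
  ultimately show "S \<le> slope_max s" by (simp add: S_def T_def)
qed

lemma flow_diff_bounds:
  assumes "\<bar>z\<bar> \<le> 1" "\<bar>z'\<bar> \<le> 1" "z \<le> z'" "s \<ge> 0"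
  shows "slope_min s * (z' - z) \<le> flow s z' - flow s z"
    and "flow s z' - flow s z \<le> slope_max s * (z' - z)"
  unfolding flow_diff[OF assms(1,2)] mult.commute[of "z' - z"]
  using flow_slope_bounds[OF assms(1,2,4)] assms(3) by (intro mult_right_mono; simp)+

text \<open>For \<open>s \<ge> 0\<close> the denominators in \<open>flow_diff\<close> grow as the
  interval moves right, so the difference quotient falls. The cross-multiplied form admits
  degenerate intervals.\<close>

lemma flow_concave:
  assumes "\<bar>a\<bar> \<le> 1" "\<bar>b\<bar> \<le> 1" "\<bar>a'\<bar> \<le> 1" "\<bar>b'\<bar> \<le> 1"
    and "a \<le> a'" "b \<le> b'" "a \<le> b" "a' \<le> b'" "s \<ge> 0"
  shows "(flow s b' - flow s a') * (b - a) \<le> (flow s b - flow s a) * (b' - a')"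
proof -
  define T where "T = tanh s"
  have T: "0 \<le> T" "T < 1" using assms tanh_real_lt_1 by (auto simp: T_def)
  have pos: "1 + T * a > 0" "1 + T * b > 0"
    using flow_denom_pos[OF assms(1), of s] flow_denom_pos[OF assms(2), of s] by (simp_all add: T_def)
  have pos': "1 + T * a' > 0" "1 + T * b' > 0"
    using flow_denom_pos[OF assms(3), of s] flow_denom_pos[OF assms(4), of s] by (simp_all add: T_def)
  have num: "1 - T\<^sup>2 \<ge> 0" using tanh_square_less_1[of s] by (auto simp: T_def)
  have "(1 - T\<^sup>2) / ((1 + T * a') * (1 + T * b')) \<le> (1 - T\<^sup>2) / ((1 + T * a) * (1 + T * b))"
    using T num pos pos' assms by (intro divide_left_mono mult_mono add_left_mono mult_left_mono) auto
  then have "((b' - a') * (b - a)) * ((1 - T\<^sup>2) / ((1 + T * a') * (1 + T * b')))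
     \<le> ((b' - a') * (b - a)) * ((1 - T\<^sup>2) / ((1 + T * a) * (1 + T * b)))"
    using assms by (intro mult_left_mono) auto
  then show ?thesis
    unfolding flow_diff[OF assms(1,2)] flow_diff[OF assms(3,4)] T_def[symmetric]
    by (simp only: mult_ac)
qed

text \<open>The competitor of the exchange argument. Its increment over \<open>q\<close> is the concave function
  \<open>flow s - slope_min s * id\<close> between \<open>q\<close> and \<open>m\<close>, scaled; this is the only choice for which
  \<open>blend_cost\<close> below holds with equality when \<open>a\<close> lies outside \<open>[q, m]\<close> and \<open>b = flow s a\<close>.\<close>

definition blend :: "real \<Rightarrow> real \<Rightarrow> real \<Rightarrow> real" where
  "blend s q m = q + (flow s m - flow s q - slope_min s * (m - q)) / slope_max s"

section \<open>Bounds, monotonicity and cost of the blend\<close>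

lemma blend_bounds:
  assumes "\<bar>q\<bar> \<le> 1" "\<bar>m\<bar> \<le> 1" "q \<le> m" "s \<ge> 0"
  shows "q \<le> blend s q m" "blend s q m \<le> m"
proof -
  note fb = flow_diff_bounds[OF assms] and sp = slope_pos[of s]
  show "q \<le> blend s q m" using fb sp by (simp add: blend_def)
  have "slope_min s * (m - q) \<ge> 0" using sp assms by simp
  then have "flow s m - flow s q - slope_min s * (m - q) \<le> (m - q) * slope_max s"
    using fb by (simp add: mult.commute)
  then have "(flow s m - flow s q - slope_min s * (m - q)) / slope_max s \<le> m - q"
    using sp by (simp add: pos_divide_le_eq)
  then show "blend s q m \<le> m" by (simp add: blend_def)
qed

text \<open>Up to the factor \<open>slope_max s\<close>, the blend is the sum of
  \<open>flow s m - slope_min s * m\<close> and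
  \<open>slope_max s * q - flow s q + slope_min s * q\<close>; the slope bounds make each summand
  increasing.\<close>

lemma blend_mono:
  assumes "\<bar>q\<bar> \<le> 1" "\<bar>m\<bar> \<le> 1" "\<bar>q'\<bar> \<le> 1" "\<bar>m'\<bar> \<le> 1" "q \<le> q'" "m \<le> m'" "s \<ge> 0"
  shows "blend s q m \<le> blend s q' m'"
proof -
  have sp: "slope_max s > 0" "slope_min s > 0" by (rule slope_pos)+
  have 1: "slope_min s * (m' - m) \<le> flow s m' - flow s m"
    using flow_diff_bounds(1)[of m m' s] assms by simp
  have 2: "flow s q' - flow s q \<le> slope_max s * (q' - q)"
    using flow_diff_bounds(2)[of q q' s] assms by simp
  have 3: "slope_min s * (q' - q) \<ge> 0" using sp assms by simp
  have e: "slope_max s * blend s a b = slope_max s * a + (flow s b - flow s a - slope_min s * (b - a))" for a b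
    using sp by (simp add: blend_def distrib_left)
  have "slope_max s * blend s q m \<le> slope_max s * blend s q' m'"
    using 1 2 3 unfolding e by (simp add: algebra_simps)
  then show ?thesis using sp by simp
qed

text \<open>This makes blending preserve \<open>flow_Lip\<close>. Concavity enters twice: by that of
  \<open>flow s\<close>, the blend sits relatively no higher in the moved interval than in the
  original one; by that of \<open>flow d\<close>, the image of the blend lies above the
  chord.\<close>

lemma blend_flow:
  assumes q: "\<bar>q\<bar> \<le> 1" and m: "\<bar>m\<bar> \<le> 1" and qm: "q \<le> m" and s: "s \<ge> 0" and d: "d \<ge> 0"
  shows "blend s (flow d q) (flow d m) \<le> flow d (blend s q m)"
proof (cases "q = m")
  case True
  then show ?thesis by (simp add: blend_def)
next
  case False
  then have lt: "m - q > 0" using qm by simp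
  let ?Q = "flow d q" and ?M = "flow d m" and ?v = "blend s q m"
  have Q: "\<bar>?Q\<bar> \<le> 1" and M: "\<bar>?M\<bar> \<le> 1" using abs_flow_le q m by auto
  have up: "q \<le> ?Q" "m \<le> ?M" using flow_mono_time[OF q, of 0 d] flow_mono_time[OF m, of 0 d] d by auto
  have QM: "?Q \<le> ?M" using flow_mono[OF q m qm] .
  note vb = blend_bounds[OF q m qm s]
  have v: "\<bar>?v\<bar> \<le> 1" using vb q m by linarith
  have sp: "slope_max s > 0" by (rule slope_pos)
  have "(flow s ?M - flow s ?Q) * (m - q) \<le> (flow s m - flow s q) * (?M - ?Q)"
    using q m Q M up qm QM s by (intro flow_concave) auto
  then have 1: "(flow s ?M - flow s ?Q - slope_min s * (?M - ?Q)) * (m - q)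
     \<le> (flow s m - flow s q - slope_min s * (m - q)) * (?M - ?Q)"
    by (simp add: algebra_simps)
  have "slope_max s * ((blend s ?Q ?M - ?Q) * (m - q)) \<le> slope_max s * ((?v - q) * (?M - ?Q))"
    using 1 sp by (simp add: blend_def)
  then have 2: "(blend s ?Q ?M - ?Q) * (m - q) \<le> (?v - q) * (?M - ?Q)"
    using sp by simp
  \<comment> \<open>Concavity with a common left end \<open>q\<close>: the quotient of
    \<open>flow d\<close> on \<open>[q, ?v]\<close> is at least that on
    \<open>[q, m]\<close>.\<close>
  have "(flow d m - flow d q) * (?v - q) \<le> (flow d ?v - flow d q) * (m - q)"
    using q m v vb qm d by (intro flow_concave) auto
  then have "(blend s ?Q ?M - ?Q) * (m - q) \<le> (flow d ?v - ?Q) * (m - q)"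
    using 2 by (simp add: mult.commute)
  then show ?thesis using lt by simp
qed

text \<open>The pointwise form of the exchange: moving \<open>q\<close> to the blend and to
  \<open>m\<close> in the cost of \<open>a\<close>, with weights \<open>slope_max s\<close> and
  \<open>slope_min s\<close>, is paid for by the cost of \<open>b\<close>.\<close>

lemma blend_cost:
  assumes a: "\<bar>a\<bar> \<le> 1" and q: "\<bar>q\<bar> \<le> 1" and m: "\<bar>m\<bar> \<le> 1" and qm: "q \<le> m" and s: "s \<ge> 0"
    and b: "b \<le> flow s a"
  shows "slope_max s * (\<bar>a - blend s q m\<bar> - \<bar>a - q\<bar>) + slope_min s * (\<bar>a - m\<bar> - \<bar>a - q\<bar>)
    + (\<bar>b - flow s q\<bar> - \<bar>b - flow s m\<bar>) \<le> 0"
proof -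
  let ?v = "blend s q m"
  note vb = blend_bounds[OF q m qm s]
  have sp: "slope_max s > 0" "slope_min s > 0" by (rule slope_pos)+
  have fqm: "flow s q \<le> flow s m" using flow_mono[OF q m qm] .
  have e: "slope_max s * ?v = slope_max s * q + (flow s m - flow s q - slope_min s * (m - q))"
    using sp by (simp add: blend_def distrib_left)
  \<comment> \<open>For \<open>p \<le> r\<close> the function
    \<open>\<bar>b - p\<bar> - \<bar>b - r\<bar>\<close> is nondecreasing in \<open>b\<close>, so
    \<open>b = flow s a\<close> is the worst case.\<close>
  have swap: "\<bar>b - flow s q\<bar> - \<bar>b - flow s m\<bar> \<le> \<bar>flow s a - flow s q\<bar> - \<bar>flow s a - flow s m\<bar>"
    using b fqm by linarith
  have "slope_max s * (\<bar>a - ?v\<bar> - \<bar>a - q\<bar>) + slope_min s * (\<bar>a - m\<bar> - \<bar>a - q\<bar>)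
    \<le> \<bar>flow s a - flow s m\<bar> - \<bar>flow s a - flow s q\<bar>"
  proof -
    \<comment> \<open>Outside \<open>[q, m]\<close> the definition of \<open>blend\<close> gives
      equality. Between \<open>q\<close> and the blend the upper slope bound suffices, between the
      blend and \<open>m\<close> the lower one.\<close>
    consider "a \<le> q" | "q \<le> a" "a \<le> ?v" | "?v \<le> a" "a \<le> m" | "m \<le> a" by linarith
    then show ?thesis
    proof cases
      case 1
      have "flow s a \<le> flow s q" using flow_mono[OF a q 1] .
      then have r: "\<bar>flow s a - flow s m\<bar> - \<bar>flow s a - flow s q\<bar> = flow s m - flow s q" using fqm by linarith
      have l: "\<bar>a - ?v\<bar> - \<bar>a - q\<bar> = ?v - q" "\<bar>a - m\<bar> - \<bar>a - q\<bar> = m - q" using 1 vb qm by linarith+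
      show ?thesis using e unfolding r l by (simp add: algebra_simps)
    next
      case 2
      have "flow s a \<le> flow s m" "flow s q \<le> flow s a"
        using flow_mono[OF q a] flow_mono[OF a m] 2 vb by auto
      then have r: "\<bar>flow s a - flow s m\<bar> - \<bar>flow s a - flow s q\<bar> = flow s m + flow s q - 2 * flow s a" by linarith
      have l: "\<bar>a - ?v\<bar> - \<bar>a - q\<bar> = ?v + q - 2 * a" "\<bar>a - m\<bar> - \<bar>a - q\<bar> = m + q - 2 * a" using 2 vb qm by linarith+
      have "flow s a - flow s q \<le> slope_max s * (a - q)"
        using flow_diff_bounds(2)[OF q a _ s] 2 by simp
      moreover have "slope_min s * (a - q) \<ge> 0" using sp 2 by simp
      ultimately show ?thesis using e unfolding r l by (simp add: algebra_simps)
    next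
      case 3
      have "flow s a \<le> flow s m" "flow s q \<le> flow s a"
        using flow_mono[OF q a] flow_mono[OF a m] 3 vb by auto
      then have r: "\<bar>flow s a - flow s m\<bar> - \<bar>flow s a - flow s q\<bar> = flow s m + flow s q - 2 * flow s a" by linarith
      have l: "\<bar>a - ?v\<bar> - \<bar>a - q\<bar> = q - ?v" "\<bar>a - m\<bar> - \<bar>a - q\<bar> = m + q - 2 * a" using 3 vb qm by linarith+
      have "slope_min s * (m - a) \<le> flow s m - flow s a"
        using flow_diff_bounds(1)[OF a m _ s] 3 by simp
      then show ?thesis using e unfolding r l by (simp add: algebra_simps)
    next
      case 4
      have "flow s m \<le> flow s a" using flow_mono[OF m a 4] .
      then have r: "\<bar>flow s a - flow s m\<bar> - \<bar>flow s a - flow s q\<bar> = flow s q - flow s m" using fqm by linarith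
      have l: "\<bar>a - ?v\<bar> - \<bar>a - q\<bar> = q - ?v" "\<bar>a - m\<bar> - \<bar>a - q\<bar> = q - m" using 4 vb qm by linarith+
      show ?thesis using e unfolding r l by (simp add: algebra_simps)
    qed
  qed
  then show ?thesis using swap by linarith
qed

section \<open>The space of profiles\<close>

text \<open>These are the functions \<open>tanh \<circ> f\<close> with \<open>f\<close> 1-Lipschitz, together with the constants \<open>1\<close> and \<open>-1\<close>:
  \<^term>\<open>flow s\<close> extends \<open>tanh r \<mapsto> tanh (r + s)\<close> to the endpoints.\<close>

definition flow_Lip :: "'a mms \<Rightarrow> ('a \<Rightarrow> real) set" where
  "flow_Lip X = {V. (\<forall>x\<in>mm_carrier X. \<bar>V x\<bar> \<le> 1) \<and>
     (\<forall>x\<in>mm_carrier X. \<forall>y\<in>mm_carrier X. V y \<le> flow (mm_dist X x y) (V x))}"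

lemma flow_LipI:
  assumes "\<And>x. x \<in> mm_carrier X \<Longrightarrow> \<bar>V x\<bar> \<le> 1"
    and "\<And>x y. x \<in> mm_carrier X \<Longrightarrow> y \<in> mm_carrier X \<Longrightarrow> V y \<le> flow (mm_dist X x y) (V x)"
  shows "V \<in> flow_Lip X"
  using assms by (auto simp: flow_Lip_def)

lemma flow_Lip_abs: "V \<in> flow_Lip X \<Longrightarrow> x \<in> mm_carrier X \<Longrightarrow> \<bar>V x\<bar> \<le> 1"
  by (simp add: flow_Lip_def)

lemma flow_LipD:
  "V \<in> flow_Lip X \<Longrightarrow> x \<in> mm_carrier X \<Longrightarrow> y \<in> mm_carrier X \<Longrightarrow> V y \<le> flow (mm_dist X x y) (V x)"
  by (simp add: flow_Lip_def)

section \<open>Identification of \<open>K_tau\<close> with the halved profiles\<close>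

lemma closedin_Collect_all_nonpos:
  fixes f :: "'i \<Rightarrow> 'a \<Rightarrow> real"
  assumes "\<And>i. i \<in> I \<Longrightarrow> continuous_map T euclideanreal (f i)"
  shows "closedin T {v \<in> topspace T. \<forall>i\<in>I. f i v \<le> 0}"
proof (cases "I = {}")
  case False
  have "closedin T (\<Inter>i\<in>I. {v \<in> topspace T. f i v \<in> {..0}})"
    using False assms by (intro closedin_INT closedin_continuous_map_preimage) auto
  moreover have "(\<Inter>i\<in>I. {v \<in> topspace T. f i v \<in> {..0}}) = {v \<in> topspace T. \<forall>i\<in>I. f i v \<le> 0}"
    using False by auto
  ultimately show ?thesis by simp
qed simp

text \<open>Constants depend continuously on their value, so limits of values of \<open>tau\<close>
  give limits of functions. It supplies the constants \<open>1/2\<close> and \<open>- 1/2\<close>,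
  values that \<open>tau\<close> only approaches.\<close>

lemma const_in_K_tau:
  assumes "c \<in> closure (range tau)"
  shows "restrict (\<lambda>_. c) (mm_carrier X) \<in> K_tau X"
proof -
  let ?T = "product_topology (\<lambda>_. euclideanreal) (mm_carrier X)"
  let ?r = "\<lambda>c. restrict (\<lambda>_. c) (mm_carrier X)"
  have "continuous_map euclideanreal ?T ?r"
    by (auto simp: continuous_map_componentwise)
  then have "?r ` (euclideanreal closure_of range tau) \<subseteq> ?T closure_of ?r ` range tau"
    by (rule continuous_map_image_closure_subset)
  also have "\<dots> \<subseteq> K_tau X"
    unfolding K_tau_def
  proof (rule closure_of_mono, safe)
    fix r
    have "?r r \<in> Lip1 X" by (auto simp: Lip1_def)
    moreover have "?r (tau r) = restrict (tau \<circ> ?r r) (mm_carrier X)" by auto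
    ultimately show "?r (tau r) \<in> (\<lambda>f. restrict (tau \<circ> f) (mm_carrier X)) ` Lip1 X" by (intro rev_image_eqI)
  qed
  finally show ?thesis using assms by auto
qed

lemma half_in_closure_range_tau: "1/2 \<in> closure (range tau)" "- 1/2 \<in> closure (range tau)"
proof -
  have t: "(\<lambda>n. tanh (real n)) \<longlonglongrightarrow> 1"
    using filterlim_compose[OF tanh_real_at_top filterlim_real_sequentially] .
  have "(\<lambda>n. tau (real n)) \<longlonglongrightarrow> 1/2" unfolding tau_def by (intro tendsto_divide t) auto
  then show "1/2 \<in> closure (range tau)"
    unfolding closure_sequential by (intro exI[of _ "\<lambda>n. tau (real n)"]) auto
  have "(\<lambda>n. tau (- real n)) \<longlonglongrightarrow> - 1/2"
    unfolding tau_def tanh_minus by (intro tendsto_divide tendsto_minus t) auto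
  then show "- 1/2 \<in> closure (range tau)"
    unfolding closure_sequential by (intro exI[of _ "\<lambda>n. tau (- real n)"]) auto
qed

text \<open>The conditions defining \<open>flow_Lip\<close> are closed under pointwise convergence,
  which gives one inclusion. Conversely, a profile that reaches 1 or -1 somewhere is constant, and
  any other is \<open>tanh\<close> of a 1-Lipschitz function.\<close>

lemma K_tau_eq: "K_tau X = (\<lambda>V. restrict (\<lambda>x. V x / 2) (mm_carrier X)) ` flow_Lip X"
proof
  let ?C = "mm_carrier X"
  let ?T = "product_topology (\<lambda>_. euclideanreal) ?C"
  \<comment> \<open>Clearing the positive denominator of \<open>flow\<close> leaves conditions that
    are continuous in the coordinates of \<open>v\<close>; the factor 2 undoes the half in
    \<open>tau\<close>.\<close>
  let ?A1 = "{v \<in> topspace ?T. \<forall>x\<in>?C. \<bar>2 * v x\<bar> - 1 \<le> 0}"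
  let ?A2 = "{v \<in> topspace ?T. \<forall>(x, y)\<in>?C \<times> ?C.
    2 * v y * (1 + tanh (mm_dist X x y) * (2 * v x)) - (2 * v x + tanh (mm_dist X x y)) \<le> 0}"
  have proj: "continuous_map ?T euclideanreal (\<lambda>v. v x)" if "x \<in> ?C" for x
    using that by (rule continuous_map_product_projection)
  have "closedin ?T ?A1"
    by (rule closedin_Collect_all_nonpos) (intro continuous_intros proj)
  moreover have "closedin ?T ?A2"
    unfolding split_beta'
    by (rule closedin_Collect_all_nonpos) (intro continuous_intros proj; auto)
  moreover have "(\<lambda>f. restrict (tau \<circ> f) ?C) ` Lip1 X \<subseteq> ?A1 \<inter> ?A2"
  proof safe
    fix f x y assume f: "f \<in> Lip1 X" and x: "x \<in> ?C" and y: "y \<in> ?C"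
    have t: "\<bar>tanh (f x)\<bar> \<le> 1" using tanh_real_lt_1[of "f x"] tanh_real_gt_neg1[of "f x"] by linarith
    show "\<bar>2 * restrict (tau \<circ> f) ?C x\<bar> - 1 \<le> 0" using t x by (simp add: tau_def)
    have "\<bar>f y - f x\<bar> \<le> mm_dist X x y" using f x y by (auto simp: Lip1_def mdist_commute)
    then have "tanh (f y) \<le> flow (mm_dist X x y) (tanh (f x))" by (simp add: flow_tanh)
    then show "2 * restrict (tau \<circ> f) ?C y * (1 + tanh (mm_dist X x y) * (2 * restrict (tau \<circ> f) ?C x))
      - (2 * restrict (tau \<circ> f) ?C x + tanh (mm_dist X x y)) \<le> 0"
      using x y flow_denom_pos[OF t, of "mm_dist X x y"] by (simp add: tau_def flow_def pos_le_divide_eq)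
  qed auto
  ultimately have "K_tau X \<subseteq> ?A1 \<inter> ?A2"
    unfolding K_tau_def by (intro closure_of_minimal closedin_Int)
  also have "\<dots> \<subseteq> (\<lambda>V. restrict (\<lambda>x. V x / 2) ?C) ` flow_Lip X"
  proof
    fix v assume v: "v \<in> ?A1 \<inter> ?A2"
    have b: "\<bar>2 * v x\<bar> \<le> 1" if "x \<in> ?C" for x using v that by auto
    have "(\<lambda>x. 2 * v x) \<in> flow_Lip X"
    proof (rule flow_LipI)
      fix x y assume x: "x \<in> ?C" and y: "y \<in> ?C"
      have "2 * v y * (1 + tanh (mm_dist X x y) * (2 * v x)) \<le> 2 * v x + tanh (mm_dist X x y)"
        using v x y by auto
      then show "2 * v y \<le> flow (mm_dist X x y) (2 * v x)"
        unfolding flow_def by (simp only: pos_le_divide_eq[OF flow_denom_pos[OF b[OF x]]])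
    qed (rule b)
    moreover have "v = restrict (\<lambda>x. 2 * v x / 2) ?C"
      using v by (auto simp: PiE_def extensional_restrict)
    ultimately show "v \<in> (\<lambda>V. restrict (\<lambda>x. V x / 2) ?C) ` flow_Lip X" by (intro rev_image_eqI)
  qed
  finally show "K_tau X \<subseteq> (\<lambda>V. restrict (\<lambda>x. V x / 2) ?C) ` flow_Lip X" .
  show "(\<lambda>V. restrict (\<lambda>x. V x / 2) ?C) ` flow_Lip X \<subseteq> K_tau X"
  proof safe
    fix V assume V: "V \<in> flow_Lip X"
    \<comment> \<open>The flow fixes 1 and -1 and is invertible, so an extreme value at one point
      spreads to all points.\<close>
    have ends: "V y = c" if c: "c = 1 \<or> c = -1" and x: "x \<in> ?C" "V x = c" and y: "y \<in> ?C" for c x y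
    proof -
      have "V y \<le> flow (mm_dist X x y) (V x)" "V x \<le> flow (mm_dist X x y) (V y)"
        using flow_LipD[OF V x(1) y] flow_LipD[OF V y x(1)] by (simp_all add: mdist_commute)
      moreover have "\<bar>V y\<bar> \<le> 1" using flow_Lip_abs[OF V y] .
      moreover have "V y = flow (- mm_dist X x y) (flow (mm_dist X x y) (V y))"
        using \<open>\<bar>V y\<bar> \<le> 1\<close> by (simp add: flow_add)
      moreover have "\<bar>flow (mm_dist X x y) (V y)\<bar> \<le> 1" using abs_flow_le \<open>\<bar>V y\<bar> \<le> 1\<close> by blast
      ultimately show ?thesis using c x(2)
        by (elim disjE) (auto simp: abs_le_iff dest: antisym)
    qed
    show "restrict (\<lambda>x. V x / 2) ?C \<in> K_tau X"
    proof (cases "\<exists>x\<in>?C. \<bar>V x\<bar> = 1")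
      case True
      then obtain x where x: "x \<in> ?C" "V x = 1 \<or> V x = -1" by (auto simp: abs_if split: if_splits)
      have "restrict (\<lambda>y. V y / 2) ?C = restrict (\<lambda>_. V x / 2) ?C"
        using ends[OF x(2) x(1)] by (auto simp: restrict_def)
      then show ?thesis
        using x(2) const_in_K_tau half_in_closure_range_tau by auto
    next
      case False
      let ?f = "restrict (\<lambda>x. artanh (V x)) ?C"
      have t: "tanh (artanh (V x)) = V x" if "x \<in> ?C" for x
        using False flow_Lip_abs[OF V that] that by (intro tanh_artanh_real) force
      have "artanh (V y) \<le> artanh (V x) + mm_dist X x y" if "x \<in> ?C" "y \<in> ?C" for x y
      proof -
        have "tanh (artanh (V y)) \<le> tanh (artanh (V x) + mm_dist X x y)"
          using flow_LipD[OF V that] flow_tanh[of "mm_dist X x y" "artanh (V x)"] t that by simp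
        then show ?thesis by simp
      qed
      then have "?f \<in> Lip1 X"
        by (fastforce simp: Lip1_def abs_le_iff mdist_commute)
      moreover have "restrict (\<lambda>x. V x / 2) ?C = restrict (tau \<circ> ?f) ?C"
        using t by (auto simp: tau_def restrict_def)
      ultimately have "restrict (\<lambda>x. V x / 2) ?C \<in> (\<lambda>f. restrict (tau \<circ> f) ?C) ` Lip1 X"
        by (intro rev_image_eqI)
      moreover have "(\<lambda>f. restrict (tau \<circ> f) ?C) ` Lip1 X \<subseteq> K_tau X"
        unfolding K_tau_def by (rule closure_of_subset) auto
      ultimately show ?thesis by blast
    qed
  qed
qed

section \<open>Closure properties of the space of profiles\<close>

lemma zero_in_flow_Lip: "(\<lambda>_. 0) \<in> flow_Lip X"
proof (rule flow_LipI)
  fix x y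
  show "0 \<le> flow (mm_dist X x y) 0" by (simp add: flow_def)
qed simp

lemma flow_Lip_flow:
  assumes V: "V \<in> flow_Lip X"
  shows "(\<lambda>x. flow s (V x)) \<in> flow_Lip X"
proof (rule flow_LipI)
  fix x y assume x: "x \<in> mm_carrier X" and y: "y \<in> mm_carrier X"
  note b = flow_Lip_abs[OF V x] flow_Lip_abs[OF V y]
  have "flow s (V y) \<le> flow s (flow (mm_dist X x y) (V x))"
    using b abs_flow_le flow_LipD[OF V x y] by (intro flow_mono) auto
  then show "flow s (V y) \<le> flow (mm_dist X x y) (flow s (V x))"
    using flow_commute[OF b(1)] by simp
qed (intro abs_flow_le flow_Lip_abs[OF V])

lemma flow_Lip_max:
  assumes V: "V \<in> flow_Lip X" and V': "V' \<in> flow_Lip X"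
  shows "(\<lambda>x. max (V x) (V' x)) \<in> flow_Lip X"
proof (rule flow_LipI)
  fix x y assume x: "x \<in> mm_carrier X" and y: "y \<in> mm_carrier X"
  note b = flow_Lip_abs[OF V x] flow_Lip_abs[OF V' x]
  have m: "\<bar>max (V x) (V' x)\<bar> \<le> 1" using b by auto
  show "max (V y) (V' y) \<le> flow (mm_dist X x y) (max (V x) (V' x))"
    using flow_LipD[OF V x y] flow_LipD[OF V' x y]
      flow_mono[OF b(1) m, of "mm_dist X x y"] flow_mono[OF b(2) m, of "mm_dist X x y"] by simp
qed (use flow_Lip_abs[OF V] flow_Lip_abs[OF V'] in \<open>auto simp: max_def\<close>)

lemma flow_Lip_min:
  assumes V: "V \<in> flow_Lip X" and V': "V' \<in> flow_Lip X"
  shows "(\<lambda>x. min (V x) (V' x)) \<in> flow_Lip X"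
proof (rule flow_LipI)
  fix x y assume x: "x \<in> mm_carrier X" and y: "y \<in> mm_carrier X"
  show "min (V y) (V' y) \<le> flow (mm_dist X x y) (min (V x) (V' x))"
    using flow_LipD[OF V x y] flow_LipD[OF V' x y] by (auto simp: min_def)
qed (use flow_Lip_abs[OF V] flow_Lip_abs[OF V'] in \<open>auto simp: min_def\<close>)

text \<open>\<open>blend_mono\<close> inserts the flow bounds of \<open>Q\<close> and
  \<open>M\<close>, and \<open>blend_flow\<close> pulls the flow out of the blend.\<close>

lemma flow_Lip_blend:
  assumes Q: "Q \<in> flow_Lip X" and M: "M \<in> flow_Lip X" and s: "s \<ge> 0"
    and QM: "\<And>x. x \<in> mm_carrier X \<Longrightarrow> Q x \<le> M x"
  shows "(\<lambda>x. blend s (Q x) (M x)) \<in> flow_Lip X"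
proof (rule flow_LipI)
  fix x y assume x: "x \<in> mm_carrier X" and y: "y \<in> mm_carrier X"
  note b = flow_Lip_abs[OF Q x] flow_Lip_abs[OF M x] flow_Lip_abs[OF Q y] flow_Lip_abs[OF M y]
  have "blend s (Q y) (M y) \<le> blend s (flow (mm_dist X x y) (Q x)) (flow (mm_dist X x y) (M x))"
    using b s flow_LipD[OF Q x y] flow_LipD[OF M x y] by (intro blend_mono abs_flow_le) auto
  also have "\<dots> \<le> flow (mm_dist X x y) (blend s (Q x) (M x))"
    using b s QM[OF x] by (intro blend_flow) auto
  finally show "blend s (Q y) (M y) \<le> flow (mm_dist X x y) (blend s (Q x) (M x))" .
next
  fix x assume x: "x \<in> mm_carrier X"
  note b = flow_Lip_abs[OF Q x] flow_Lip_abs[OF M x]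
  show "\<bar>blend s (Q x) (M x)\<bar> \<le> 1" using blend_bounds[OF b QM[OF x] s] b by linarith
qed

section \<open>Lipschitz estimate, measurability and sections\<close>

lemma flow_Lip_Lipschitz:
  assumes V: "V \<in> flow_Lip X" and x: "x \<in> mm_carrier X" and y: "y \<in> mm_carrier X"
  shows "\<bar>V x - V y\<bar> \<le> 4 * mm_dist X x y"
  using flow_LipD[OF V x y] flow_LipD[OF V y x] flow_le_add[OF flow_Lip_abs[OF V x], of "mm_dist X x y"]
    flow_le_add[OF flow_Lip_abs[OF V y], of "mm_dist X x y"] by (simp add: mdist_commute)

lemma flow_Lip_measurable:
  assumes X: "mm_space X" and V: "V \<in> flow_Lip X"
  shows "V \<in> borel_measurable (mm_measure X)"
proof (rule borel_measurableI)
  fix S :: "real set" assume S: "open S"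
  have "openin (mm_topology X) (V -` S \<inter> mm_carrier X)"
    unfolding openin_mtopology_of
  proof (intro conjI ballI)
    fix x assume x: "x \<in> V -` S \<inter> mm_carrier X"
    then obtain e where e: "e > 0" "\<And>r. dist r (V x) < e \<Longrightarrow> r \<in> S"
      using S unfolding open_dist by blast
    show "\<exists>r>0. \<forall>y\<in>mm_carrier X. mm_dist X x y < r \<longrightarrow> y \<in> V -` S \<inter> mm_carrier X"
    proof (intro exI[of _ "e / 4"] conjI ballI impI)
      fix y assume y: "y \<in> mm_carrier X" "mm_dist X x y < e / 4"
      then have "dist (V y) (V x) < e"
        using flow_Lip_Lipschitz[OF V, of x y] x by (simp add: dist_real_def abs_minus_commute)
      then show "y \<in> V -` S \<inter> mm_carrier X" using e y by simp
    qed (use e in simp)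
  qed auto
  then show "V -` S \<inter> space (mm_measure X) \<in> sets (mm_measure X)"
    using X by (simp add: mm_space_space) (simp add: mm_space_def openin_sets_borel_of)
qed

lemma mdist_self: "x \<in> mspace m \<Longrightarrow> mdist m x x = 0"
  by simp

lemma flow_Lip_section:
  assumes U: "U \<in> flow_Lip (X \<times>\<^sub>1 W)" and w: "w \<in> mm_carrier W"
  shows "(\<lambda>x. U (x, w)) \<in> flow_Lip X"
proof (rule flow_LipI)
  fix x y assume "x \<in> mm_carrier X" "y \<in> mm_carrier X"
  then show "U (y, w) \<le> flow (mm_dist X x y) (U (x, w))"
    using flow_LipD[OF U, of "(x, w)" "(y, w)"] w by (simp add: mdist_self)
qed (use flow_Lip_abs[OF U] w in auto)

lemma flow_Lip_fst:
  assumes u: "u \<in> flow_Lip X"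
  shows "(\<lambda>p. u (fst p)) \<in> flow_Lip (X \<times>\<^sub>1 W)"
proof (rule flow_LipI)
  fix p q assume "p \<in> mm_carrier (X \<times>\<^sub>1 W)" "q \<in> mm_carrier (X \<times>\<^sub>1 W)"
  then obtain x w y w' where p: "p = (x, w)" "q = (y, w')" "x \<in> mm_carrier X" "y \<in> mm_carrier X" by auto
  then show "u (fst q) \<le> flow (mm_dist (X \<times>\<^sub>1 W) p q) (u (fst p))"
    using flow_LipD[OF u, of x y] flow_mono_time[OF flow_Lip_abs[OF u, of x],
        of "mm_dist X x y" "mm_dist X x y + mm_dist W w w'"] by simp
qed (use flow_Lip_abs[OF u] in auto)

lemma flow_Lip_section_le:
  assumes U: "U \<in> flow_Lip (X \<times>\<^sub>1 W)" and "x \<in> mm_carrier X" "w \<in> mm_carrier W" "w' \<in> mm_carrier W"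
  shows "U (x, w') \<le> flow (mm_dist W w w') (U (x, w))"
  using flow_LipD[OF U, of "(x, w)" "(x, w')"] assms by (simp add: mdist_self)

section \<open>Near-optimal approximants\<close>

text \<open>Subtracting a distance before applying \<open>tanh\<close> is a flow of negative time,
  so this is the maximum of cones with apexes \<open>c 0\<close>, ..., \<open>c n\<close>: there are
  \<open>n + 1\<close> of them.\<close>

primrec cone_max :: "'c mms \<Rightarrow> (nat \<Rightarrow> 'c) \<Rightarrow> (nat \<Rightarrow> 'b \<Rightarrow> real) \<Rightarrow> nat \<Rightarrow> 'b \<times> 'c \<Rightarrow> real" where
  "cone_max W c v 0 = (\<lambda>(y, w). flow (- mm_dist W w (c 0)) (v 0 y))"
| "cone_max W c v (Suc n) =
     (\<lambda>(y, w). max (cone_max W c v n (y, w)) (flow (- mm_dist W w (c (Suc n))) (v (Suc n) y)))"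

text \<open>Flow times add, so the claim reduces to the triangle inequality in \<open>W\<close>; the
  sum of the two times is the \<ell>1 distance.\<close>

lemma cone_in_flow_Lip:
  assumes v: "v \<in> flow_Lip Y" and c: "c \<in> mm_carrier W"
  shows "(\<lambda>(y, w). flow (- mm_dist W w c) (v y)) \<in> flow_Lip (Y \<times>\<^sub>1 W)"
proof (rule flow_LipI)
  fix p q assume "p \<in> mm_carrier (Y \<times>\<^sub>1 W)" "q \<in> mm_carrier (Y \<times>\<^sub>1 W)"
  then obtain x w y w' where p: "p = (x, w)" "q = (y, w')" "x \<in> mm_carrier Y" "y \<in> mm_carrier Y"
    "w \<in> mm_carrier W" "w' \<in> mm_carrier W" by auto
  note b = flow_Lip_abs[OF v p(3)] flow_Lip_abs[OF v p(4)]
  have "flow (- mm_dist W w' c) (v y) \<le> flow (- mm_dist W w' c) (flow (mm_dist Y x y) (v x))"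
    using b flow_LipD[OF v p(3,4)] by (intro flow_mono abs_flow_le)
  also have "\<dots> \<le> flow ((mm_dist Y x y + mm_dist W w w') + - mm_dist W w c) (v x)"
    unfolding flow_add[OF b(1)]
    using mdist_triangle[OF p(5,6) c] by (intro flow_mono_time b) simp
  finally show "(case q of (y, w) \<Rightarrow> flow (- mm_dist W w c) (v y))
      \<le> flow (mm_dist (Y \<times>\<^sub>1 W) p q) (case p of (y, w) \<Rightarrow> flow (- mm_dist W w c) (v y))"
    unfolding p(1,2) mm_dist_l1_prod prod.case flow_add[OF b(1)] .
qed (use flow_Lip_abs[OF v] abs_flow_le in auto)

lemma cone_max_in_flow_Lip:
  assumes "\<And>i. i \<le> n \<Longrightarrow> v i \<in> flow_Lip Y" and "\<And>i. i \<le> n \<Longrightarrow> c i \<in> mm_carrier W"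
  shows "cone_max W c v n \<in> flow_Lip (Y \<times>\<^sub>1 W)"
  using assms
proof (induction n)
  case (Suc n)
  have "cone_max W c v n \<in> flow_Lip (Y \<times>\<^sub>1 W)" using Suc by simp
  from flow_Lip_max[OF this cone_in_flow_Lip[of "v (Suc n)" Y "c (Suc n)" W]]
  show ?case using Suc.prems by (simp add: split_beta')
qed (simp add: cone_in_flow_Lip)

text \<open>At its own apex a cone has flow time 0.\<close>

lemma cone_max_ge:
  assumes "i \<le> n" "c i \<in> mm_carrier W"
  shows "v i y \<le> cone_max W c v n (y, c i)"
  using assms
proof (induction n)
  case (Suc n)
  then show ?case by (cases "i = Suc n") (auto simp: mdist_self max_def)
qed (simp add: mdist_self)

text \<open>Instantiated with \<open>(fst, snd)\<close> and with \<open>(snd, fst)\<close> on a coupling, this covers both halves of the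
  Hausdorff distance.\<close>

locale mm_pair = prob_space P for P :: "'z measure" +
  fixes X :: "'a mms" and Y :: "'b mms" and \<phi> :: "'z \<Rightarrow> 'a" and \<psi> :: "'z \<Rightarrow> 'b"
  assumes X: "mm_space X" and Y: "mm_space Y"
    and \<phi> [measurable]: "\<phi> \<in> P \<rightarrow>\<^sub>M mm_measure X" and \<psi> [measurable]: "\<psi> \<in> P \<rightarrow>\<^sub>M mm_measure Y"
begin

lemma \<phi>_carrier: "z \<in> space P \<Longrightarrow> \<phi> z \<in> mm_carrier X"
  using measurable_space[OF \<phi>] mm_space_space[OF X] by auto

lemma \<psi>_carrier: "z \<in> space P \<Longrightarrow> \<psi> z \<in> mm_carrier Y"
  using measurable_space[OF \<psi>] mm_space_space[OF Y] by auto

text \<open>The factor 1/2 is that of \<open>tau\<close>: this is the mean distance of the halved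
  profiles.\<close>

definition cost :: "('a \<Rightarrow> real) \<Rightarrow> ('b \<Rightarrow> real) \<Rightarrow> real" where
  "cost u v = (\<integral>z. \<bar>u (\<phi> z) - v (\<psi> z)\<bar> / 2 \<partial>P)"

definition near_opt :: "('a \<Rightarrow> real) \<Rightarrow> real \<Rightarrow> ('b \<Rightarrow> real) \<Rightarrow> bool" where
  "near_opt u \<epsilon> v \<longleftrightarrow> v \<in> flow_Lip Y \<and> (\<forall>v'\<in>flow_Lip Y. cost u v \<le> cost u v' + \<epsilon>)"

lemma integrand_le:
  assumes "u \<in> flow_Lip X" "v \<in> flow_Lip Y" "z \<in> space P"
  shows "\<bar>u (\<phi> z) - v (\<psi> z)\<bar> / 2 \<le> 1"
  using flow_Lip_abs[OF assms(1) \<phi>_carrier[OF assms(3)]] flow_Lip_abs[OF assms(2) \<psi>_carrier[OF assms(3)]]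
  by (simp add: abs_le_iff)

lemma cost_integrable:
  assumes u: "u \<in> flow_Lip X" and v: "v \<in> flow_Lip Y"
  shows "integrable P (\<lambda>z. \<bar>u (\<phi> z) - v (\<psi> z)\<bar> / 2)"
proof (rule integrable_const_bound[of _ 1])
  note [measurable] = flow_Lip_measurable[OF X u] flow_Lip_measurable[OF Y v]
  show "(\<lambda>z. \<bar>u (\<phi> z) - v (\<psi> z)\<bar> / 2) \<in> borel_measurable P" by measurable
  show "AE z in P. norm (\<bar>u (\<phi> z) - v (\<psi> z)\<bar> / 2) \<le> 1"
    using integrand_le[OF u v] by (intro AE_I2) auto
qed

lemma cost_nonneg: "cost u v \<ge> 0"
  unfolding cost_def by (rule integral_nonneg_AE) auto

lemma nn_integral_cost:
  assumes "u \<in> flow_Lip X" "v \<in> flow_Lip Y"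
  shows "(\<integral>\<^sup>+z. ennreal (\<bar>u (\<phi> z) - v (\<psi> z)\<bar> / 2) \<partial>P) = ennreal (cost u v)"
  unfolding cost_def by (rule nn_integral_eq_integral[OF cost_integrable[OF assms]]) auto

lemma near_opt_exists:
  assumes "\<epsilon> > 0"
  shows "\<exists>v. near_opt u \<epsilon> v"
proof -
  let ?I = "INF v\<in>flow_Lip Y. cost u v"
  have bdd: "bdd_below (cost u ` flow_Lip Y)" using cost_nonneg by (intro bdd_belowI[of _ 0]) auto
  have "?I < ?I + \<epsilon>" using assms by simp
  then obtain v where "v \<in> flow_Lip Y" "cost u v < ?I + \<epsilon>"
    using zero_in_flow_Lip by (subst (asm) cINF_less_iff[OF _ bdd]) auto
  moreover have "?I \<le> cost u v'" if "v' \<in> flow_Lip Y" for v' using cINF_lower[OF bdd that] .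
  ultimately show ?thesis unfolding near_opt_def by (intro exI[of _ v]) fastforce
qed

section \<open>The exchange argument and its loss of accuracy\<close>

lemma near_opt_mono: "near_opt u \<epsilon> v \<Longrightarrow> \<epsilon> \<le> \<delta> \<Longrightarrow> near_opt u \<delta> v"
  unfolding near_opt_def by fastforce

text \<open>The summand 1 is the error of the old approximant; the quotient collects
  \<open>slope_max s + 1\<close> errors of competitors, divided by the weight
  \<open>slope_min s\<close> of the new one.\<close>

definition loss :: "real \<Rightarrow> real" where
  "loss s = 1 + (slope_max s + 1) / slope_min s"

lemma loss_ge_1: "loss s \<ge> 1"
  using slope_pos[of s] by (simp add: loss_def)

text \<open>Integrating \<open>blend_cost\<close> weighs three replacements: \<open>v\<close> by
  \<open>B\<close> and \<open>v\<close> by \<open>M\<close> in the cost of \<open>u\<close>, and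
  \<open>v'\<close> by \<open>m\<close> in the cost of \<open>u'\<close>. By near-optimality the
  first and the third save at most \<epsilon> each, which bounds the loss in the second.\<close>

lemma near_opt_max:
  assumes u: "u \<in> flow_Lip X" and u': "u' \<in> flow_Lip X" and s: "s \<ge> 0"
    and le: "\<And>x. x \<in> mm_carrier X \<Longrightarrow> u' x \<le> flow s (u x)"
    and v: "near_opt u \<epsilon> v" and v': "near_opt u' \<epsilon> v'"
  shows "near_opt u (loss s * \<epsilon>) (\<lambda>y. max (v y) (flow (- s) (v' y)))"
proof -
  have vL: "v \<in> flow_Lip Y" and vL': "v' \<in> flow_Lip Y" using v v' by (auto simp: near_opt_def)
  define M where "M = (\<lambda>y. max (v y) (flow (- s) (v' y)))"
  define B where "B = (\<lambda>y. blend s (v y) (M y))"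
  define m where "m = (\<lambda>y. min (v' y) (flow s (v y)))"
  have M_Lip: "M \<in> flow_Lip Y" unfolding M_def by (intro flow_Lip_max flow_Lip_flow vL vL')
  have B_Lip: "B \<in> flow_Lip Y" unfolding B_def by (intro flow_Lip_blend vL M_Lip s) (simp add: M_def)
  have m_Lip: "m \<in> flow_Lip Y" unfolding m_def by (intro flow_Lip_min flow_Lip_flow vL vL')
  have sp: "slope_max s > 0" "slope_min s > 0" by (rule slope_pos)+
  let ?c = "\<lambda>u v z. \<bar>u (\<phi> z) - v (\<psi> z)\<bar> / 2"
  have pt: "slope_max s * (?c u B z - ?c u v z) + slope_min s * (?c u M z - ?c u v z)
      + (?c u' m z - ?c u' v' z) \<le> 0" if z: "z \<in> space P" for z
  proof -
    let ?x = "\<phi> z" and ?y = "\<psi> z"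
    have b: "\<bar>u ?x\<bar> \<le> 1" "\<bar>v ?y\<bar> \<le> 1" "\<bar>v' ?y\<bar> \<le> 1" "\<bar>M ?y\<bar> \<le> 1"
      using u vL vL' M_Lip \<phi>_carrier[OF z] \<psi>_carrier[OF z] by (auto intro: flow_Lip_abs)
    have "slope_max s * (\<bar>u ?x - B ?y\<bar> - \<bar>u ?x - v ?y\<bar>) + slope_min s * (\<bar>u ?x - M ?y\<bar> - \<bar>u ?x - v ?y\<bar>)
      + (\<bar>u' ?x - flow s (v ?y)\<bar> - \<bar>u' ?x - flow s (M ?y)\<bar>) \<le> 0"
      unfolding B_def by (rule blend_cost[OF b(1,2,4) _ s le[OF \<phi>_carrier[OF z]]]) (simp add: M_def)
    \<comment> \<open>At each point \<open>m\<close> and \<open>flow s \<circ> M\<close> are the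
      minimum and maximum of \<open>v'\<close> and \<open>flow s \<circ> v\<close>, so both pairs
      have the same two values.\<close>
    moreover have "\<bar>u' ?x - flow s (v ?y)\<bar> - \<bar>u' ?x - flow s (M ?y)\<bar> = \<bar>u' ?x - m ?y\<bar> - \<bar>u' ?x - v' ?y\<bar>"
    proof -
      have inv: "flow s (flow (- s) (v' ?y)) = v' ?y" "flow (- s) (flow s (v ?y)) = v ?y"
        using b by (simp_all add: flow_add)
      note fb = abs_flow_le[OF b(3), of "- s"] abs_flow_le[OF b(2), of s]
      show ?thesis
      proof (cases "v ?y \<le> flow (- s) (v' ?y)")
        case True
        then have "flow s (v ?y) \<le> v' ?y" using flow_mono[OF b(2) fb(1) True, of s] inv by simp
        then show ?thesis using True inv by (simp add: M_def m_def max_def min_def)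
      next
        case False
        then have "v' ?y \<le> flow s (v ?y)" using flow_mono[OF fb(1) b(2), of s] inv by simp
        then show ?thesis using False inv by (simp add: M_def m_def max_def min_def)
      qed
    qed
    ultimately have "(slope_max s * (\<bar>u ?x - B ?y\<bar> - \<bar>u ?x - v ?y\<bar>)
      + slope_min s * (\<bar>u ?x - M ?y\<bar> - \<bar>u ?x - v ?y\<bar>) + (\<bar>u' ?x - m ?y\<bar> - \<bar>u' ?x - v' ?y\<bar>)) / 2 \<le> 0"
      by simp
    then show ?thesis by (simp add: field_simps)
  qed
  note int = cost_integrable[OF u B_Lip] cost_integrable[OF u M_Lip] cost_integrable[OF u vL]
    cost_integrable[OF u' m_Lip] cost_integrable[OF u' vL']
  have "slope_max s * (cost u B - cost u v) + slope_min s * (cost u M - cost u v) + (cost u' m - cost u' v')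
     = (\<integral>z. slope_max s * (?c u B z - ?c u v z) + slope_min s * (?c u M z - ?c u v z)
      + (?c u' m z - ?c u' v' z) \<partial>P)"
    unfolding cost_def using int
    by (simp only: Bochner_Integration.integral_add Bochner_Integration.integral_diff
        Bochner_Integration.integrable_add Bochner_Integration.integrable_diff
        integral_mult_right_zero integrable_mult_right)
  also have "\<dots> \<le> (\<integral>z. 0 \<partial>P)"
    using int pt by (intro integral_mono Bochner_Integration.integrable_add
        Bochner_Integration.integrable_diff integrable_mult_right) auto
  also have "\<dots> = 0" by simp
  finally have main: "slope_max s * (cost u B - cost u v) + slope_min s * (cost u M - cost u v)
     + (cost u' m - cost u' v') \<le> 0" .
  have "cost u v \<le> cost u B + \<epsilon>" "cost u' v' \<le> cost u' m + \<epsilon>"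
    using v v' B_Lip m_Lip by (auto simp: near_opt_def)
  moreover from this have "slope_max s * (- \<epsilon>) \<le> slope_max s * (cost u B - cost u v)"
    using sp by (intro mult_left_mono) auto
  ultimately have "slope_min s * (cost u M - cost u v) \<le> (slope_max s + 1) * \<epsilon>"
    using main by (simp add: algebra_simps)
  then have "cost u M - cost u v \<le> (slope_max s + 1) * \<epsilon> / slope_min s"
    using sp by (simp add: pos_le_divide_eq mult.commute)
  then have "cost u M + \<epsilon> \<le> cost u v + loss s * \<epsilon>"
    by (simp add: loss_def algebra_simps add_divide_distrib)
  moreover have "cost u v \<le> cost u w + \<epsilon>" if "w \<in> flow_Lip Y" for w
    using v that by (simp add: near_opt_def)
  ultimately have "cost u M \<le> cost u w + loss s * \<epsilon>" if "w \<in> flow_Lip Y" for w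
    using that by (smt (verit))
  then show ?thesis
    using M_Lip unfolding near_opt_def M_def[symmetric] by simp
qed

text \<open>The slice of the cone maximum at \<open>c i\<close> arises from \<open>v i\<close> by
  successive exchanges with the \<open>v j\<close>. Each is an instance of
  \<open>near_opt_max\<close> with \<open>s\<close> the distance of \<open>c i\<close> and
  \<open>c j\<close>, because the slices of \<open>U\<close> differ by at most that flow.\<close>

lemma near_opt_cone_max:
  fixes c :: "nat \<Rightarrow> 'c"
  assumes U: "U \<in> flow_Lip (X \<times>\<^sub>1 W)" and c: "\<And>i. c i \<in> mm_carrier W" and "\<delta> > 0"
  shows "\<exists>V\<in>flow_Lip (Y \<times>\<^sub>1 W). \<forall>i\<le>n. near_opt (\<lambda>x. U (x, c i)) \<delta> (\<lambda>y. V (y, c i))"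
proof -
  define u where "u = (\<lambda>i x. U (x, c i))"
  define L where "L = Max ((\<lambda>(i, j). loss (mm_dist W (c i) (c j))) ` ({..n} \<times> {..n}))"
  have L: "loss (mm_dist W (c i) (c j)) \<le> L" if "i \<le> n" "j \<le> n" for i j
    unfolding L_def using that by (intro Max_ge finite_imageI) auto
  have L1: "L \<ge> 1" using order_trans[OF loss_ge_1 L[of 0 0]] by simp
  \<comment> \<open>There are \<open>n + 1\<close> exchanges, each multiplying the error by at most
    \<open>L\<close>, so the final error is \<delta>.\<close>
  define \<epsilon> where "\<epsilon> = \<delta> / L ^ Suc n"
  have \<epsilon>: "\<epsilon> > 0" using \<open>\<delta> > 0\<close> L1 by (simp add: \<epsilon>_def)
  have "\<forall>i. \<exists>v. near_opt (u i) \<epsilon> v" using near_opt_exists[OF \<epsilon>] by blast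
  then obtain v where v: "\<And>i. near_opt (u i) \<epsilon> (v i)" by metis
  have uL: "u i \<in> flow_Lip X" for i unfolding u_def by (rule flow_Lip_section[OF U c])
  have step: "near_opt (u i) (L * \<eta>) (\<lambda>y. max (g y) (flow (- mm_dist W (c i) (c j)) (v j y)))"
    if "i \<le> n" "j \<le> n" "near_opt (u i) \<eta> g" "\<epsilon> \<le> \<eta>" for i j \<eta> g
  proof -
    have "near_opt (u i) (loss (mm_dist W (c i) (c j)) * \<eta>)
        (\<lambda>y. max (g y) (flow (- mm_dist W (c i) (c j)) (v j y)))"
    proof (rule near_opt_max[OF uL uL[of j]])
      show "near_opt (u j) \<eta> (v j)" using near_opt_mono[OF v that(4)] .
      show "u j x \<le> flow (mm_dist W (c i) (c j)) (u i x)" if "x \<in> mm_carrier X" for x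
        unfolding u_def by (rule flow_Lip_section_le[OF U that c c])
    qed (use that in auto)
    then show ?thesis
      by (rule near_opt_mono) (use L[OF that(1,2)] that(4) \<epsilon> in \<open>auto intro!: mult_right_mono\<close>)
  qed
  \<comment> \<open>The induction starts from \<open>v i\<close> and adds one cone at a time.
    Already \<open>k = 0\<close> is an exchange, with the cone of index 0, hence the exponent
    \<open>Suc k\<close>.\<close>
  have ind: "near_opt (u i) (L ^ Suc k * \<epsilon>) (\<lambda>y. max (v i y) (cone_max W c v k (y, c i)))"
    if "i \<le> n" "k \<le> n" for i k
    using that(2)
  proof (induction k)
    case 0
    then show ?case using step[OF that(1) _ v[of i], of 0] by simp
  next
    case (Suc k)
    have "1 * \<epsilon> \<le> L ^ Suc k * \<epsilon>" using L1 \<epsilon> by (intro mult_right_mono one_le_power) auto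
    then show ?case
      using step[OF that(1) Suc.prems Suc.IH] Suc.prems by (simp add: max.assoc mult.assoc)
  qed
  have "near_opt (u i) \<delta> (\<lambda>y. cone_max W c v n (y, c i))" if "i \<le> n" for i
  proof -
    have "L ^ Suc n * \<epsilon> = \<delta>" using L1 by (simp add: \<epsilon>_def)
    moreover have "max (v i y) (cone_max W c v n (y, c i)) = cone_max W c v n (y, c i)" for y
      by (rule max_absorb2[OF cone_max_ge[OF that c]])
    ultimately show ?thesis using ind[OF that order_refl] by simp
  qed
  moreover have "cone_max W c v n \<in> flow_Lip (Y \<times>\<^sub>1 W)"
    using v c by (intro cone_max_in_flow_Lip) (auto simp: near_opt_def)
  ultimately show ?thesis unfolding u_def by blast
qed

section \<open>From finitely many slices to all of \<open>W\<close>\<close>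

lemma cost_section_le:
  assumes U: "U \<in> flow_Lip (X \<times>\<^sub>1 W)" and V: "V \<in> flow_Lip (Y \<times>\<^sub>1 W)"
    and w: "w \<in> mm_carrier W" and c: "c \<in> mm_carrier W"
  shows "cost (\<lambda>x. U (x, w)) (\<lambda>y. V (y, w)) \<le> cost (\<lambda>x. U (x, c)) (\<lambda>y. V (y, c)) + 4 * mm_dist W w c"
proof -
  have "cost (\<lambda>x. U (x, w)) (\<lambda>y. V (y, w))
      \<le> (\<integral>z. \<bar>U (\<phi> z, c) - V (\<psi> z, c)\<bar> / 2 + 4 * mm_dist W w c \<partial>P)"
    unfolding cost_def
  proof (rule integral_mono)
    show "integrable P (\<lambda>z. \<bar>U (\<phi> z, w) - V (\<psi> z, w)\<bar> / 2)"
      by (rule cost_integrable[OF flow_Lip_section[OF U w] flow_Lip_section[OF V w]])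
    show "integrable P (\<lambda>z. \<bar>U (\<phi> z, c) - V (\<psi> z, c)\<bar> / 2 + 4 * mm_dist W w c)"
      by (intro Bochner_Integration.integrable_add integrable_const
          cost_integrable[OF flow_Lip_section[OF U c] flow_Lip_section[OF V c]])
    fix z assume z: "z \<in> space P"
    have "\<bar>U (\<phi> z, w) - U (\<phi> z, c)\<bar> \<le> 4 * mm_dist W w c"
      using flow_Lip_Lipschitz[OF U, of "(\<phi> z, w)" "(\<phi> z, c)"] \<phi>_carrier[OF z] w c by (simp add: mdist_self)
    moreover have "\<bar>V (\<psi> z, w) - V (\<psi> z, c)\<bar> \<le> 4 * mm_dist W w c"
      using flow_Lip_Lipschitz[OF V, of "(\<psi> z, w)" "(\<psi> z, c)"] \<psi>_carrier[OF z] w c by (simp add: mdist_self)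
    \<comment> \<open>Both functions move by at most four times the distance; the half in the cost
      turns 8 back into 4.\<close>
    ultimately have "\<bar>U (\<phi> z, w) - V (\<psi> z, w)\<bar> \<le> \<bar>U (\<phi> z, c) - V (\<psi> z, c)\<bar> + 8 * mm_dist W w c"
      by linarith
    then show "\<bar>U (\<phi> z, w) - V (\<psi> z, w)\<bar> / 2 \<le> \<bar>U (\<phi> z, c) - V (\<psi> z, c)\<bar> / 2 + 4 * mm_dist W w c"
      by simp
  qed
  also have "\<dots> = cost (\<lambda>x. U (x, c)) (\<lambda>y. V (y, c)) + 4 * mm_dist W w c"
    unfolding cost_def using cost_integrable[OF flow_Lip_section[OF U c] flow_Lip_section[OF V c]]
    by (simp add: prob_space)
  finally show ?thesis .
qed

text \<open>One of the two one-sided terms of the Hausdorff distance.\<close>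

definition deviation :: ennreal where
  "deviation = (SUP u\<in>flow_Lip X. INF v\<in>flow_Lip Y. \<integral>\<^sup>+z. ennreal (\<bar>u (\<phi> z) - v (\<psi> z)\<bar> / 2) \<partial>P)"

definition fibre_cost :: "'c mms \<Rightarrow> ('a \<times> 'c \<Rightarrow> real) \<Rightarrow> ('b \<times> 'c \<Rightarrow> real) \<Rightarrow> ennreal" where
  "fibre_cost W U V =
     (\<integral>\<^sup>+w. (\<integral>\<^sup>+z. ennreal (\<bar>U (\<phi> z, w) - V (\<psi> z, w)\<bar> / 2) \<partial>P) \<partial>mm_measure W)"

lemma near_opt_le_deviation:
  assumes u: "u \<in> flow_Lip X" and v: "near_opt u \<delta> v" and "\<delta> > 0"
  shows "ennreal (cost u v) \<le> deviation + ennreal \<delta>"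
proof -
  have "ennreal (cost u v) - ennreal \<delta>
      \<le> (INF v\<in>flow_Lip Y. \<integral>\<^sup>+z. ennreal (\<bar>u (\<phi> z) - v (\<psi> z)\<bar> / 2) \<partial>P)"
  proof (rule INF_greatest)
    fix v' assume v': "v' \<in> flow_Lip Y"
    have "cost u v - \<delta> \<le> cost u v'" using v v' by (auto simp: near_opt_def)
    then show "ennreal (cost u v) - ennreal \<delta> \<le> (\<integral>\<^sup>+z. ennreal (\<bar>u (\<phi> z) - v' (\<psi> z)\<bar> / 2) \<partial>P)"
      unfolding nn_integral_cost[OF u v'] using \<open>\<delta> > 0\<close> by (simp add: ennreal_minus ennreal_leI)
  qed
  also have "\<dots> \<le> deviation" unfolding deviation_def by (rule SUP_upper[OF u])
  finally show ?thesis by (simp add: ennreal_minus_le_iff add.commute)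
qed

text \<open>Let the slices of \<open>V n\<close> be \<open>1 / (n + 1)\<close>-optimal at the first
  \<open>n + 1\<close> points of a dense sequence. Lipschitz dependence on \<open>w\<close> bounds
  the limsup of the costs in every fibre, and the reverse Fatou lemma integrates the bound.\<close>

lemma fibre_cost_INF_le:
  assumes W: "mm_space W" and U: "U \<in> flow_Lip (X \<times>\<^sub>1 W)"
  shows "(INF V\<in>flow_Lip (Y \<times>\<^sub>1 W). fibre_cost W U V) \<le> deviation"
proof -
  interpret W: prob_space "mm_measure W" using W by (simp add: mm_space_def)
  have carrier: "mm_carrier W \<noteq> {}" using W.not_empty mm_space_space[OF W] by simp
  obtain C where C: "countable C" "C \<subseteq> mm_carrier W" "mm_topology W closure_of C = mm_carrier W"
    using W by (auto simp: mm_space_def separable_space_def)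
  have "C \<noteq> {}" using C carrier by auto
  \<comment> \<open>If \<open>C\<close> is finite, the enumeration repeats points; only its range
    matters.\<close>
  define c where "c = from_nat_into C"
  have c: "c i \<in> mm_carrier W" for i using from_nat_into[OF \<open>C \<noteq> {}\<close>] C by (auto simp: c_def)
  have dense: "\<exists>i. mm_dist W w (c i) < e" if w: "w \<in> mm_carrier W" and "e > 0" for w e
  proof -
    interpret Metric_space "mm_carrier W" "mm_dist W" by simp
    have "w \<in> mtopology closure_of C" using C w by (simp add: mtopology_of_def)
    then obtain b where "b \<in> C" "mm_dist W w b < e" using \<open>e > 0\<close> by (auto simp: metric_closure_of)
    moreover have "range c = C" unfolding c_def using range_from_nat_into[OF \<open>C \<noteq> {}\<close> C(1)] .
    ultimately show ?thesis by (metis rangeE)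
  qed
  have "\<exists>V\<in>flow_Lip (Y \<times>\<^sub>1 W).
      \<forall>i\<le>n. near_opt (\<lambda>x. U (x, c i)) (1 / real (Suc n)) (\<lambda>y. V (y, c i))" for n
    by (rule near_opt_cone_max[OF U c]) simp
  then have "\<forall>n. \<exists>V. V \<in> flow_Lip (Y \<times>\<^sub>1 W) \<and>
      (\<forall>i\<le>n. near_opt (\<lambda>x. U (x, c i)) (1 / real (Suc n)) (\<lambda>y. V (y, c i)))"
    by (simp only: Bex_def simp_thms)
  from choice[OF this] obtain V where VV: "\<forall>n. V n \<in> flow_Lip (Y \<times>\<^sub>1 W) \<and>
      (\<forall>i\<le>n. near_opt (\<lambda>x. U (x, c i)) (1 / real (Suc n)) (\<lambda>y. V n (y, c i)))"
    by (elim exE)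
  have V: "V n \<in> flow_Lip (Y \<times>\<^sub>1 W)" for n
    using VV by (elim allE[of _ n] conjE)
  have opt: "near_opt (\<lambda>x. U (x, c i)) (1 / real (Suc n)) (\<lambda>y. V n (y, c i))" if "i \<le> n" for n i
    using VV that by (elim allE[of _ n] conjE allE[of _ i] impE)
  let ?f = "\<lambda>n w. \<integral>\<^sup>+z. ennreal (\<bar>U (\<phi> z, w) - V n (\<psi> z, w)\<bar> / 2) \<partial>P"
  have limsup: "limsup (\<lambda>n. ?f n w) \<le> deviation" if w: "w \<in> mm_carrier W" for w
  proof (rule ennreal_le_epsilon)
    fix e :: real assume e: "e > 0"
    \<comment> \<open>With the factor 4 from \<open>cost_section_le\<close> this contributes at most
      \<open>e / 2\<close>; the accuracy of \<open>V n\<close> contributes the other half.\<close>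
    obtain i where i: "mm_dist W w (c i) < e / 8" using dense[OF w, of "e / 8"] e by auto
    obtain N where N: "1 / real (Suc N) < e / 2" using e nat_approx_posE[of "e / 2"] by auto
    have "?f n w \<le> deviation + ennreal e" if n: "n \<ge> max i N" for n
    proof -
      have "1 / real (Suc n) \<le> 1 / real (Suc N)" using n by (intro divide_left_mono) auto
      then have small: "1 / real (Suc n) + 4 * mm_dist W w (c i) \<le> e" using N i by linarith
      have "?f n w = ennreal (cost (\<lambda>x. U (x, w)) (\<lambda>y. V n (y, w)))"
        using nn_integral_cost[OF flow_Lip_section[OF U w] flow_Lip_section[OF V w]] .
      also have "\<dots> \<le> ennreal (cost (\<lambda>x. U (x, c i)) (\<lambda>y. V n (y, c i)) + 4 * mm_dist W w (c i))"
        by (intro ennreal_leI cost_section_le[OF U V w c])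
      also have "\<dots> = ennreal (cost (\<lambda>x. U (x, c i)) (\<lambda>y. V n (y, c i))) + ennreal (4 * mm_dist W w (c i))"
        by (intro ennreal_plus cost_nonneg) simp
      also have "\<dots> \<le> (deviation + ennreal (1 / real (Suc n))) + ennreal (4 * mm_dist W w (c i))"
        using n by (intro add_right_mono near_opt_le_deviation flow_Lip_section[OF U c] opt) auto
      also have "\<dots> = deviation + ennreal (1 / real (Suc n) + 4 * mm_dist W w (c i))"
        by (simp add: ennreal_plus add.assoc)
      also have "\<dots> \<le> deviation + ennreal e" by (intro add_left_mono ennreal_leI small)
      finally show ?thesis .
    qed
    then show "limsup (\<lambda>n. ?f n w) \<le> deviation + ennreal e"
      by (intro Limsup_bounded eventually_sequentiallyI[of "max i N"])
  qed
  have U_meas: "U \<in> borel_measurable (mm_measure X \<Otimes>\<^sub>M mm_measure W)"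
    using flow_Lip_measurable[OF mm_space_l1_prod[OF X W] U] by simp
  have V_meas: "V n \<in> borel_measurable (mm_measure Y \<Otimes>\<^sub>M mm_measure W)" for n
    using flow_Lip_measurable[OF mm_space_l1_prod[OF Y W] V] by simp
  note [measurable] = U_meas V_meas
  have "(INF V\<in>flow_Lip (Y \<times>\<^sub>1 W). fibre_cost W U V) \<le> limsup (\<lambda>n. integral\<^sup>N (mm_measure W) (?f n))"
    unfolding fibre_cost_def
    by (rule order_trans[OF Liminf_bounded Liminf_le_Limsup[OF sequentially_bot]])
       (intro always_eventually allI INF_lower V)
  also have "\<dots> \<le> (\<integral>\<^sup>+ w. limsup (\<lambda>n. ?f n w) \<partial>mm_measure W)"
  \<comment> \<open>Reverse Fatou, with the constant 1 as integrable dominating function.\<close>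
  proof (rule nn_integral_limsup[where w = "\<lambda>_. 1"])
    show "?f n \<in> borel_measurable (mm_measure W)" for n by measurable
    have "?f n w \<le> 1" if w: "w \<in> mm_carrier W" for n w
    proof -
      have "?f n w \<le> (\<integral>\<^sup>+z. 1 \<partial>P)"
        using integrand_le[OF flow_Lip_section[OF U w] flow_Lip_section[OF V w]]
        by (intro nn_integral_mono) auto
      then show ?thesis by (simp add: emeasure_space_1)
    qed
    then show "AE w in mm_measure W. ?f n w \<le> 1" for n
      by (intro AE_I2) (simp add: mm_space_space[OF W])
  qed (auto simp: W.emeasure_space_1)
  also have "\<dots> \<le> (\<integral>\<^sup>+ w. deviation \<partial>mm_measure W)"
    using limsup by (intro nn_integral_mono) (simp add: mm_space_space[OF W])
  also have "\<dots> = deviation" by (simp add: W.emeasure_space_1)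
  finally show ?thesis .
qed

text \<open>For the remaining inequality, lift \<open>u\<close> along \<open>fst\<close>. Each slice
  of any \<open>V\<close> competes with the approximants of \<open>u\<close> on \<open>Y\<close>, so
  every fibre costs at least the infimum, and so does their average.\<close>

lemma deviation_eq_fibre:
  assumes W: "mm_space W"
  shows "(SUP U\<in>flow_Lip (X \<times>\<^sub>1 W). INF V\<in>flow_Lip (Y \<times>\<^sub>1 W). fibre_cost W U V) = deviation"
proof (rule antisym)
  show "(SUP U\<in>flow_Lip (X \<times>\<^sub>1 W). INF V\<in>flow_Lip (Y \<times>\<^sub>1 W). fibre_cost W U V) \<le> deviation"
    by (intro SUP_least fibre_cost_INF_le[OF W])
  interpret W: prob_space "mm_measure W" using W by (simp add: mm_space_def)
  show "deviation \<le> (SUP U\<in>flow_Lip (X \<times>\<^sub>1 W). INF V\<in>flow_Lip (Y \<times>\<^sub>1 W). fibre_cost W U V)"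
    unfolding deviation_def
  proof (rule SUP_least)
    fix u assume u: "u \<in> flow_Lip X"
    let ?I = "INF v\<in>flow_Lip Y. \<integral>\<^sup>+z. ennreal (\<bar>u (\<phi> z) - v (\<psi> z)\<bar> / 2) \<partial>P"
    have "?I \<le> fibre_cost W (\<lambda>p. u (fst p)) V" if V: "V \<in> flow_Lip (Y \<times>\<^sub>1 W)" for V
    proof -
      have "?I = (\<integral>\<^sup>+w. ?I \<partial>mm_measure W)" by (simp add: W.emeasure_space_1)
      also have "\<dots> \<le> fibre_cost W (\<lambda>p. u (fst p)) V"
        unfolding fibre_cost_def fst_conv
      proof (rule nn_integral_mono)
        fix w assume "w \<in> space (mm_measure W)"
        then have "(\<lambda>y. V (y, w)) \<in> flow_Lip Y"
          using flow_Lip_section[OF V] mm_space_space[OF W] by simp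
        then show "?I \<le> (\<integral>\<^sup>+z. ennreal (\<bar>u (\<phi> z) - V (\<psi> z, w)\<bar> / 2) \<partial>P)"
          by (rule INF_lower)
      qed
      finally show ?thesis .
    qed
    then have "?I \<le> (INF V\<in>flow_Lip (Y \<times>\<^sub>1 W). fibre_cost W (\<lambda>p. u (fst p)) V)"
      by (intro INF_greatest)
    then show "?I \<le> (SUP U\<in>flow_Lip (X \<times>\<^sub>1 W). INF V\<in>flow_Lip (Y \<times>\<^sub>1 W). fibre_cost W U V)"
      by (rule SUP_upper2[OF flow_Lip_fst[OF u]])
  qed
qed

end

section \<open>Couplings\<close>

text \<open>The diagonal gives both points the same \<open>W\<close>-coordinate, so only slices over
  the same \<open>w\<close> are compared; the rest is change of variables and Tonelli.\<close>

lemma nn_integral_prod_coupling_diag: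
  assumes X: "mm_space X" and Y: "mm_space Y" and W: "mm_space W" and pi: "\<pi> \<in> couplings X Y"
    and U: "U \<in> flow_Lip (X \<times>\<^sub>1 W)" and V: "V \<in> flow_Lip (Y \<times>\<^sub>1 W)"
  shows "(\<integral>\<^sup>+p. ennreal (\<bar>U (fst p) - V (snd p)\<bar> / 2) \<partial>prod_coupling X Y W \<pi> (diag_coupling W))
    = (\<integral>\<^sup>+w. (\<integral>\<^sup>+z. ennreal (\<bar>U (fst z, w) - V (snd z, w)\<bar> / 2) \<partial>\<pi>) \<partial>mm_measure W)"
proof -
  let ?\<rho> = "diag_coupling W"
  let ?B = "borel_of (prod_topology (mm_topology (X \<times>\<^sub>1 W)) (mm_topology (Y \<times>\<^sub>1 W)))"
  let ?g = "\<lambda>((x, y), (w, w')). ((x, w), (y, w'))"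
  note rho = diag_coupling_in_couplings[OF W]
  have [measurable_cong]: "sets \<pi> = sets (mm_measure X \<Otimes>\<^sub>M mm_measure Y)"
    using pi mm_space_sets_prod[OF X Y] by (simp add: couplings_def)
  have [measurable_cong]: "sets ?\<rho> = sets (mm_measure W \<Otimes>\<^sub>M mm_measure W)"
    using rho mm_space_sets_prod[OF W W] by (simp add: couplings_def)
  have [measurable_cong]: "sets ?B = sets ((mm_measure X \<Otimes>\<^sub>M mm_measure W) \<Otimes>\<^sub>M (mm_measure Y \<Otimes>\<^sub>M mm_measure W))"
    using mm_space_sets_prod[OF mm_space_l1_prod[OF X W] mm_space_l1_prod[OF Y W]] by simp
  note [measurable_cong] = mm_space_sets_prod[OF W W]
  interpret P: prob_space \<pi> using pi by (simp add: couplings_def)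
  interpret R: prob_space ?\<rho> using rho by (simp add: couplings_def)
  interpret PR: pair_prob_space \<pi> ?\<rho> ..
  have [measurable]: "U \<in> borel_measurable (mm_measure X \<Otimes>\<^sub>M mm_measure W)"
    "V \<in> borel_measurable (mm_measure Y \<Otimes>\<^sub>M mm_measure W)"
    using flow_Lip_measurable[OF mm_space_l1_prod[OF X W] U]
      flow_Lip_measurable[OF mm_space_l1_prod[OF Y W] V] by simp_all
  have g: "?g \<in> \<pi> \<Otimes>\<^sub>M ?\<rho> \<rightarrow>\<^sub>M ?B" unfolding split_beta' by measurable
  let ?h = "\<lambda>(z, q). ennreal (\<bar>U (fst z, fst q) - V (snd z, snd q)\<bar> / 2)"
  have "(\<integral>\<^sup>+p. ennreal (\<bar>U (fst p) - V (snd p)\<bar> / 2) \<partial>prod_coupling X Y W \<pi> ?\<rho>)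
      = (\<integral>\<^sup>+r. ennreal (\<bar>U (fst (?g r)) - V (snd (?g r))\<bar> / 2) \<partial>(\<pi> \<Otimes>\<^sub>M ?\<rho>))"
    unfolding prod_coupling_def by (rule nn_integral_distr[OF g]) measurable
  also have "\<dots> = integral\<^sup>N (\<pi> \<Otimes>\<^sub>M ?\<rho>) ?h"
    by (simp add: split_beta')
  also have "\<dots> = (\<integral>\<^sup>+q. (\<integral>\<^sup>+z. ?h (z, q) \<partial>\<pi>) \<partial>?\<rho>)"
    by (rule PR.nn_integral_snd[symmetric]) measurable
  also have "\<dots> = (\<integral>\<^sup>+w. (\<integral>\<^sup>+z. ?h (z, (w, w)) \<partial>\<pi>) \<partial>mm_measure W)"
    unfolding diag_coupling_def by (rule nn_integral_distr) measurable
  finally show ?thesis by simp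
qed

section \<open>Hausdorff distances in terms of profiles\<close>

lemma hausdorff_dist_image:
  "hausdorff_dist d (f ` A) (g ` B)
    = max (SUP a\<in>A. INF b\<in>B. d (f a) (g b)) (SUP b\<in>B. INF a\<in>A. d (f a) (g b))"
  by (simp add: hausdorff_dist_def image_image)

text \<open>In the second term the difference is reversed to match \<open>mm_pair\<close> with the
  two spaces exchanged.\<close>

lemma D_tau_flow_Lip:
  assumes pi: "\<pi> \<in> couplings X Y"
  shows "D_tau \<pi> X Y = max
    (SUP u\<in>flow_Lip X. INF v\<in>flow_Lip Y. \<integral>\<^sup>+z. ennreal (\<bar>u (fst z) - v (snd z)\<bar> / 2) \<partial>\<pi>)
    (SUP v\<in>flow_Lip Y. INF u\<in>flow_Lip X. \<integral>\<^sup>+z. ennreal (\<bar>v (snd z) - u (fst z)\<bar> / 2) \<partial>\<pi>)"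
proof -
  have sp: "space \<pi> = mm_carrier X \<times> mm_carrier Y"
    using pi sets_eq_imp_space_eq[of \<pi>] by (auto simp: couplings_def)
  have 1: "mean_dist \<pi> (restrict (\<lambda>x. u x / 2) (mm_carrier X) \<circ> fst) (restrict (\<lambda>y. v y / 2) (mm_carrier Y) \<circ> snd)
     = (\<integral>\<^sup>+z. ennreal (\<bar>u (fst z) - v (snd z)\<bar> / 2) \<partial>\<pi>)" for u v
    unfolding mean_dist_def by (intro nn_integral_cong) (auto simp: sp simp flip: diff_divide_distrib)
  have 2: "(\<integral>\<^sup>+z. ennreal (\<bar>v (snd z) - u (fst z)\<bar> / 2) \<partial>\<pi>)
     = (\<integral>\<^sup>+z. ennreal (\<bar>u (fst z) - v (snd z)\<bar> / 2) \<partial>\<pi>)" for u :: "'a \<Rightarrow> real" and v :: "'b \<Rightarrow> real"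
    by (simp add: abs_minus_commute)
  show ?thesis
    unfolding D_tau_def K_tau_eq image_image hausdorff_dist_image 1 2 ..
qed

lemma D_tau_prod_coupling:
  assumes X: "mm_space X" and Y: "mm_space Y" and W: "mm_space W" and pi: "\<pi> \<in> couplings X Y"
  shows "D_tau (prod_coupling X Y W \<pi> (diag_coupling W)) (X \<times>\<^sub>1 W) (Y \<times>\<^sub>1 W) = D_tau \<pi> X Y"
proof -
  let ?\<kappa> = "prod_coupling X Y W \<pi> (diag_coupling W)"
  interpret P: prob_space \<pi> using pi by (simp add: couplings_def)
  have [measurable_cong]: "sets \<pi> = sets (mm_measure X \<Otimes>\<^sub>M mm_measure Y)"
    using pi mm_space_sets_prod[OF X Y] by (simp add: couplings_def)
  interpret A: mm_pair \<pi> X Y fst snd by unfold_locales (use X Y in measurable)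
  interpret B: mm_pair \<pi> Y X snd fst by unfold_locales (use X Y in measurable)
  have A: "(\<integral>\<^sup>+p. ennreal (\<bar>U (fst p) - V (snd p)\<bar> / 2) \<partial>?\<kappa>) = A.fibre_cost W U V"
    if "U \<in> flow_Lip (X \<times>\<^sub>1 W)" "V \<in> flow_Lip (Y \<times>\<^sub>1 W)" for U V
    unfolding A.fibre_cost_def by (rule nn_integral_prod_coupling_diag[OF X Y W pi that])
  have B: "(\<integral>\<^sup>+p. ennreal (\<bar>V (snd p) - U (fst p)\<bar> / 2) \<partial>?\<kappa>) = B.fibre_cost W V U"
    if "U \<in> flow_Lip (X \<times>\<^sub>1 W)" "V \<in> flow_Lip (Y \<times>\<^sub>1 W)" for U V
    unfolding B.fibre_cost_def
    using nn_integral_prod_coupling_diag[OF X Y W pi that] by (simp add: abs_minus_commute)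
  have "D_tau ?\<kappa> (X \<times>\<^sub>1 W) (Y \<times>\<^sub>1 W) = max
      (SUP U\<in>flow_Lip (X \<times>\<^sub>1 W). INF V\<in>flow_Lip (Y \<times>\<^sub>1 W). A.fibre_cost W U V)
      (SUP V\<in>flow_Lip (Y \<times>\<^sub>1 W). INF U\<in>flow_Lip (X \<times>\<^sub>1 W). B.fibre_cost W V U)"
    unfolding D_tau_flow_Lip[OF prod_coupling_in_couplings[OF X Y W pi]]
    by (intro arg_cong2[where f = max] SUP_cong INF_cong refl A B)
  also have "\<dots> = max A.deviation B.deviation"
    unfolding A.deviation_eq_fibre[OF W] B.deviation_eq_fibre[OF W] ..
  also have "\<dots> = D_tau \<pi> X Y"
    unfolding D_tau_flow_Lip[OF pi] A.deviation_def B.deviation_def ..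
  finally show ?thesis .
qed

theorem theorem6p7:
  fixes X :: "'a mms" and Y :: "'b mms" and W :: "'c mms"
  assumes "mm_space X" and "mm_space Y" and "mm_space W"
  shows "(\<forall>\<pi>\<in>couplings X Y.
            D_tau (prod_coupling X Y W \<pi> (diag_coupling W)) (X \<times>\<^sub>1 W) (Y \<times>\<^sub>1 W) = D_tau \<pi> X Y)
       \<and> d_tau (X \<times>\<^sub>1 W) (Y \<times>\<^sub>1 W) \<le> d_tau X Y"
proof
  show eq: "\<forall>\<pi>\<in>couplings X Y.
      D_tau (prod_coupling X Y W \<pi> (diag_coupling W)) (X \<times>\<^sub>1 W) (Y \<times>\<^sub>1 W) = D_tau \<pi> X Y"
    using D_tau_prod_coupling[OF assms] by blast
  show "d_tau (X \<times>\<^sub>1 W) (Y \<times>\<^sub>1 W) \<le> d_tau X Y"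
    unfolding d_tau_def
  proof (rule INF_mono)
    fix \<pi> assume "\<pi> \<in> couplings X Y"
    then show "\<exists>\<kappa>\<in>couplings (X \<times>\<^sub>1 W) (Y \<times>\<^sub>1 W). D_tau \<kappa> (X \<times>\<^sub>1 W) (Y \<times>\<^sub>1 W) \<le> D_tau \<pi> X Y"
      using eq prod_coupling_in_couplings[OF assms] by (metis order_refl)
  qed
qed

end
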